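(* Let $\beta\in(\beta_*,\beta^* )$, $t_0>0$, $y^{0,0}\in Y$, $\hat\delta^* := \frac{\beta}{2+\beta+2\sqrt{1+\beta}}$, $\hat\delta\in(0,\hat\delta^* )$ and $\varepsilon_p := \frac{t_0\hat\delta}{2(\nu+2\sqrt\nu)(1+\hat\delta)}$. Consider the following algorithm: for $j=0,1,\dots$, compute a point $\bar x^j\in\mathrm{int}(X)$ with $\|c+A^Ty^{0,j}-t_0\nabla F(\bar x^j)\|^*_{x^c}\le\varepsilon_p$; set $g_j := A\bar x^j-b$, $H_j := \frac1{t_0}A\nabla^2F(\bar x^j)^{-1}A^T$ and $\bar\lambda_j := \left[\frac1{t_0}g_j^TH_j^{-1}g_j\right]^{1/2}$; if $\bar\lambda_j\le\beta$ then terminate with $y^0 := y^{0,j}$; otherwise set $y^{0,j+1} := y^{0,j}-\alpha_jH_j^{-1}g_j$ with $$\alpha_j := \frac{(1-\hat\delta)\bar\lambda_j-2\hat\delta+\sqrt{(1-\hat\delta)^2\bar\lambda_j^2-4\hat\delta\bar\lambda_j}}{2\bar\lambda_j(1+\bar\lambda_j)}.$$ Then the number of iterations before this algorithm terminates does not exceed $$J_{\max} := \left\lfloor\frac{d_{\bar\delta}(y^{0,0},t_0)-d^*(t_0)+t_0\,\omega_*(\hat\delta)}{t_0\,\omega(\underline\eta)}\right\rfloor+1,$$ where $d^*(t_0)=\min_{y\in Y}d(y,t_0)$, $d_{\bar\delta}(y^{0,0},t_0) := c^T\bar x^0+(y^{0,0})^T(A\bar x^0-b)-t_0[F(\bar x^0)-F(x^c)]$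 and $$\underline\eta := \frac{\beta\left[(1-\hat\delta)\beta-2\hat\delta+\sqrt{(1-\hat\delta)^2\beta^2-4\hat\delta\beta}\right]}{(1+\hat\delta)\beta+\sqrt{(1-\hat\delta)^2\beta^2-4\hat\delta\beta}}.$$
   Context: Setting. $X_i\subset\mathbb{R}^{n_i}$ ($i=1,2$) is a bounded closed convex set with nonempty interior and $F_i$ is a $\nu_i$-self-concordant barrier for $X_i$ (standard self-concordant, i.e. $|D^3F_i(x)[h,h,h]|\le 2(h^T\nabla^2F_i(x)h)^{3/2}$, with domain $\mathrm{int}(X_i)$, tending to $+\infty$ at the boundary, and $(\nabla F_i(x)^Th)^2\le\nu_i\,h^T\nabla^2F_i(x)h$). $X=X_1\times X_2$, $n=n_1+n_2$, $F(x)=F_1(x_1)+F_2(x_2)$, $\nu=\nu_1+\nu_2$, $x^c=\arg\min_{\mathrm{int}(X)}F$. $A=[A_1,A_2]\in\mathbb{R}^{m\times n}$ has full row rank, $b\in\mathbb{R}^m$, $c\in\mathbb{R}^n$. The primal problem is $\max\{c^Tx : Ax=b,\ x\in X\}$; its solution set is nonempty, and either the Slater condition ($\mathrm{ri}(X)\cap\{Ax=b\}\ne\emptyset$) holds or $X$ is polyhedral. For $t>0$, $d(y,t)=\max_{x\in\mathrm{int}(X)}\{c^Tx+y^T(Ax-b)-t[F(x)-F(x^c)]\}$. $Y\subset\mathbb{R}^m$ is a set over which minimizing $d(\cdot,t_0)$ is the same as minimizing it over $\mathbb{R}^m$ (for instance $Y=\mathbb{R}^m$), the minimum being attained. Norm: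 $\|u\|^*_{x}=(u^T\nabla^2F(x)^{-1}u)^{1/2}$. $\omega(s)=s-\ln(1+s)$, $\omega_*(s)=-s-\ln(1-s)$. The numbers $\beta_*<\beta^*$: fix a parameter $\bar\delta\in[0,\bar\delta_{\max})$, let $p=\bar\delta[(1-\bar\delta)^{-2}+2(1-\bar\delta)^{-1}]$ and $\mathcal P(\beta)=c_0+c_1\beta+c_2\beta^2+c_3\beta^3$ with $c_0=-2\bar\delta(1-\bar\delta)^2$, $c_1=(1-\bar\delta)[(1+\bar\delta)^2-p]$, $c_2=p-3-2\bar\delta^2+2\bar\delta$, $c_3=1-\bar\delta$. Here $\bar\delta_{\max}\approx0.0432863855$ is the smallest positive $\bar\delta$ at which the discriminant of $\mathcal P$ vanishes. Then $\mathcal P$ has three nonnegative real roots, and $\beta_*<\beta^*$ denote the first and second of them; one has $\beta^*<1$. *)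

theory Defs
  imports "HOL-Analysis.Analysis" "HOL-Computational_Algebra.Polynomial"
begin

subsection \<open>Gradient, Hessian, self-concordant barriers\<close>

definition gradient :: "('a::real_inner \<Rightarrow> real) \<Rightarrow> 'a \<Rightarrow> 'a" where
  "gradient f x = (THE D. GDERIV f x :> D)"

definition hessian :: "(real^'n \<Rightarrow> real) \<Rightarrow> real^'n \<Rightarrow> real^'n^'n" where
  "hessian f x = jacobian (gradient f) (at x)"

text \<open>The third differential on the diagonal: the derivative of the Hessian
  in direction \<open>h\<close> is again a matrix, evaluated as a quadratic form at \<open>h\<close>.\<close>

definition third_diff :: "(real^'n \<Rightarrow> real) \<Rightarrow> real^'n \<Rightarrow> real^'n \<Rightarrow> real" where
  "third_diff f x h = h \<bullet> (frechet_derivative (hessian f) (at x) h *v h)"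

text \<open>Three times continuously differentiable, for an open set \<open>S\<close>. In finite dimension,
  continuity of the third derivative is continuity of its value at each fixed direction.\<close>

definition C3_on :: "(real^'n) set \<Rightarrow> (real^'n \<Rightarrow> real) \<Rightarrow> bool" where
  "C3_on S f \<longleftrightarrow> f differentiable_on S \<and> gradient f differentiable_on S \<and>
     hessian f differentiable_on S \<and>
     (\<forall>h. continuous_on S (\<lambda>x. frechet_derivative (hessian f) (at x) h))"

definition self_concordant_on :: "(real^'n) set \<Rightarrow> (real^'n \<Rightarrow> real) \<Rightarrow> bool" where
  "self_concordant_on S f \<longleftrightarrow> convex_on S f \<and> C3_on S f \<and>
     (\<forall>x\<in>S. \<forall>h. \<bar>third_diff f x h\<bar> \<le> 2 * (h \<bullet> (hessian f x *v h)) powr (3/2))"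

text \<open>The barrier has domain \<open>interior X\<close>; the values of \<open>f\<close> elsewhere are irrelevant.\<close>

definition self_concordant_barrier :: "real \<Rightarrow> (real^'n) set \<Rightarrow> (real^'n \<Rightarrow> real) \<Rightarrow> bool" where
  "self_concordant_barrier \<nu> X f \<longleftrightarrow>
     self_concordant_on (interior X) f \<and>
     (\<forall>z\<in>frontier X. filterlim f at_top (at z within interior X)) \<and>
     (\<forall>x\<in>interior X. \<forall>h. (gradient f x \<bullet> h)\<^sup>2 \<le> \<nu> * (h \<bullet> (hessian f x *v h)))"

text \<open>The local dual norm \<open>(u\<^sup>T \<nabla>\<^sup>2F(x)\<^sup>-\<^sup>1 u)\<^sup>1\<^sup>/\<^sup>2\<close>.\<close>

definition dual_norm :: "(real^'n \<Rightarrow> real) \<Rightarrow> real^'n \<Rightarrow> real^'n \<Rightarrow> real" where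
  "dual_norm F x u = sqrt (u \<bullet> (matrix_inv (hessian F x) *v u))"

definition omega :: "real \<Rightarrow> real" where
  "omega s = s - ln (1 + s)"

definition omega_star :: "real \<Rightarrow> real" where
  "omega_star s = - s - ln (1 - s)"


subsection \<open>The separable problem\<close>

text \<open>The space of dimension \<open>n\<^sub>1 + n\<^sub>2\<close> is \<open>real^('n1 + 'n2)\<close>; a vector \<open>x = (x\<^sub>1, x\<^sub>2)\<close> has
  the blocks below, and a matrix of type \<open>real^('n1 + 'n2)^'m\<close> is a block row \<open>[A\<^sub>1, A\<^sub>2]\<close>.\<close>

definition block1 :: "real^('n1::finite + 'n2::finite) \<Rightarrow> real^'n1" where
  "block1 x = (\<chi> i. x $ Inl i)"

definition block2 :: "real^('n1::finite + 'n2::finite) \<Rightarrow> real^'n2" where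
  "block2 x = (\<chi> i. x $ Inr i)"

definition block_product :: "(real^'n1) set \<Rightarrow> (real^'n2) set \<Rightarrow> (real^('n1::finite + 'n2::finite)) set" where
  "block_product X1 X2 = {x. block1 x \<in> X1 \<and> block2 x \<in> X2}"

definition block_sum ::
  "(real^'n1 \<Rightarrow> real) \<Rightarrow> (real^'n2 \<Rightarrow> real) \<Rightarrow> real^('n1::finite + 'n2::finite) \<Rightarrow> real" where
  "block_sum F1 F2 x = F1 (block1 x) + F2 (block2 x)"

definition lagrangian_smoothed ::
  "(real^'n \<Rightarrow> real) \<Rightarrow> real^'n \<Rightarrow> real^'n^'m \<Rightarrow> real^'m \<Rightarrow> real^'n \<Rightarrow> real \<Rightarrow> real^'m \<Rightarrow> real^'n \<Rightarrow> real"
  where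
  "lagrangian_smoothed F xc A b c t y x = c \<bullet> x + y \<bullet> (A *v x - b) - t * (F x - F xc)"

text \<open>For a barrier \<open>F\<close> of a bounded \<open>X\<close> with minimizer \<open>xc\<close> and for \<open>t > 0\<close>, the supremum
  is finite and attained, i.e. it is a maximum.\<close>

definition smoothed_dual ::
  "(real^'n) set \<Rightarrow> (real^'n \<Rightarrow> real) \<Rightarrow> real^'n \<Rightarrow> real^'n^'m \<Rightarrow> real^'m \<Rightarrow> real^'n \<Rightarrow> real^'m \<Rightarrow> real \<Rightarrow> real"
  where
  "smoothed_dual X F xc A b c y t = (SUP x\<in>interior X. lagrangian_smoothed F xc A b c t y x)"


subsection \<open>The bounds on the neighbourhood parameter\<close>

definition crit_poly :: "real \<Rightarrow> real poly" where
  "crit_poly \<delta> =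
     (let p = \<delta> * (1 / (1 - \<delta>)\<^sup>2 + 2 / (1 - \<delta>))
      in [: - 2 * \<delta> * (1 - \<delta>)\<^sup>2,
            (1 - \<delta>) * ((1 + \<delta>)\<^sup>2 - p),
            p - 3 - 2 * \<delta>\<^sup>2 + 2 * \<delta>,
            1 - \<delta> :])"

definition cubic_discriminant :: "real poly \<Rightarrow> real" where
  "cubic_discriminant q =
     (let c0 = coeff q 0; c1 = coeff q 1; c2 = coeff q 2; c3 = coeff q 3
      in c1\<^sup>2 * c2\<^sup>2 - 4 * c3 * c1 ^ 3 - 4 * c2 ^ 3 * c0 - 27 * c3\<^sup>2 * c0\<^sup>2 + 18 * c3 * c2 * c1 * c0)"

text \<open>The infimum is attained (the discriminant is continuous on \<open>[0, 1)\<close>, equals 5 at 0, and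
  changes sign near 0.0433), so this is the smallest positive zero.\<close>

definition delta_bar_max :: real where
  "delta_bar_max = Inf {\<delta>. 0 < \<delta> \<and> cubic_discriminant (crit_poly \<delta>) = 0}"

text \<open>For \<open>0 \<le> \<delta> < delta_bar_max\<close> the discriminant is positive, so the list of roots in
  increasing order has three distinct entries; these are its first and second.\<close>

definition beta_lower :: "real \<Rightarrow> real" where
  "beta_lower \<delta> = sorted_list_of_set {\<beta>. poly (crit_poly \<delta>) \<beta> = 0} ! 0"

definition beta_upper :: "real \<Rightarrow> real" where
  "beta_upper \<delta> = sorted_list_of_set {\<beta>. poly (crit_poly \<delta>) \<beta> = 0} ! 1"


subsection \<open>The algorithm\<close>

definition delta_hat_star :: "real \<Rightarrow> real" where
  "delta_hat_star \<beta> = \<beta> / (2 + \<beta> + 2 * sqrt (1 + \<beta>))"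

definition accuracy :: "real \<Rightarrow> real \<Rightarrow> real \<Rightarrow> real" where
  "accuracy \<nu> t \<delta> = t * \<delta> / (2 * (\<nu> + 2 * sqrt \<nu>) * (1 + \<delta>))"

definition residual :: "real^'n^'m \<Rightarrow> real^'m \<Rightarrow> real^'n \<Rightarrow> real^'m" where
  "residual A b x = A *v x - b"

definition dual_hessian :: "(real^'n \<Rightarrow> real) \<Rightarrow> real^'n^'m \<Rightarrow> real \<Rightarrow> real^'n \<Rightarrow> real^'m^'m" where
  "dual_hessian F A t x = (1 / t) *\<^sub>R (A ** matrix_inv (hessian F x) ** transpose A)"

definition newton_direction ::
  "(real^'n \<Rightarrow> real) \<Rightarrow> real^'n^'m \<Rightarrow> real^'m \<Rightarrow> real \<Rightarrow> real^'n \<Rightarrow> real^'m" where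
  "newton_direction F A b t x = matrix_inv (dual_hessian F A t x) *v residual A b x"

definition newton_decrement ::
  "(real^'n \<Rightarrow> real) \<Rightarrow> real^'n^'m \<Rightarrow> real^'m \<Rightarrow> real \<Rightarrow> real^'n \<Rightarrow> real" where
  "newton_decrement F A b t x = sqrt (1 / t * (residual A b x \<bullet> newton_direction F A b t x))"

definition step_size :: "real \<Rightarrow> real \<Rightarrow> real" where
  "step_size \<delta> l =
     ((1 - \<delta>) * l - 2 * \<delta> + sqrt ((1 - \<delta>)\<^sup>2 * l\<^sup>2 - 4 * \<delta> * l)) / (2 * l * (1 + l))"

definition eta_lower :: "real \<Rightarrow> real \<Rightarrow> real" where
  "eta_lower \<delta> \<beta> =
     \<beta> * ((1 - \<delta>) * \<beta> - 2 * \<delta> + sqrt ((1 - \<delta>)\<^sup>2 * \<beta>\<^sup>2 - 4 * \<delta> * \<beta>))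
       / ((1 + \<delta>) * \<beta> + sqrt ((1 - \<delta>)\<^sup>2 * \<beta>\<^sup>2 - 4 * \<delta> * \<beta>))"

text \<open>\<open>xbar\<close> and \<open>y\<close> record a run of the algorithm with tolerance \<open>\<epsilon>\<close>. Iteration \<open>j\<close> is
  executed iff the stopping test failed in all earlier iterations, and only executed iterations
  are constrained; after termination the sequences are arbitrary.\<close>

definition algorithm_run ::
  "(real^'n) set \<Rightarrow> (real^'n \<Rightarrow> real) \<Rightarrow> real^'n \<Rightarrow> real^'n^'m \<Rightarrow> real^'m \<Rightarrow> real^'n \<Rightarrow>
   real \<Rightarrow> real \<Rightarrow> real \<Rightarrow> real \<Rightarrow> (nat \<Rightarrow> real^'n) \<Rightarrow> (nat \<Rightarrow> real^'m) \<Rightarrow> bool" where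
  "algorithm_run X F xc A b c t \<epsilon> \<delta> \<beta> xbar y \<longleftrightarrow>
     (\<forall>j. (\<forall>k<j. \<not> newton_decrement F A b t (xbar k) \<le> \<beta>) \<longrightarrow>
        xbar j \<in> interior X \<and>
        dual_norm F xc (c + transpose A *v y j - t *\<^sub>R gradient F (xbar j)) \<le> \<epsilon> \<and>
        (\<not> newton_decrement F A b t (xbar j) \<le> \<beta> \<longrightarrow>
           y (Suc j) = y j - step_size \<delta> (newton_decrement F A b t (xbar j))
                             *\<^sub>R newton_direction F A b t (xbar j)))"

text \<open>The stopping test succeeds for the first time in iteration \<open>J\<close>; since counting starts
  at 0, exactly \<open>J + 1\<close> iterations are then executed.\<close>

definition terminates_in ::
  "(real^'n \<Rightarrow> real) \<Rightarrow> real^'n^'m \<Rightarrow> real^'m \<Rightarrow> real \<Rightarrow> real \<Rightarrow> (nat \<Rightarrow> real^'n) \<Rightarrow> nat \<Rightarrow> bool" where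
  "terminates_in F A b t \<beta> xbar J \<longleftrightarrow>
     newton_decrement F A b t (xbar J) \<le> \<beta> \<and>
     (\<forall>k<J. \<not> newton_decrement F A b t (xbar k) \<le> \<beta>)"

end

theory Submission
  imports Defs
begin

text \<open>
  The algorithm is a damped Newton method for the smoothed dual function
  \<open>d y = max L y x\<close>, where \<open>L y\<close> is linear minus \<open>t F\<close> and the maximizer is replaced by an
  approximate one \<open>x\<close>. The bound on the number of iterations holds because each step that is
  taken lowers \<open>d\<close> by at least \<open>t omega \<eta>\<close>, where \<open>\<eta>\<close> is the value of \<open>eta_lower\<close> at \<open>\<beta>\<close>, while
  \<open>d\<close> starts at most \<open>t omega_star \<delta>\<close> above the computed value of \<open>L\<close> and never falls below its
  minimum.

  Both estimates of \<open>d\<close> come from one inequality on the primal side. A self-concordant \<open>F\<close> lies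
  above its tangent plane at \<open>x\<close> by at least \<open>omega\<close> of the local distance (lemma
  \<open>self_concordant_lower_bounds\<close>).
  Since \<open>omega_star\<close> is the conjugate function of \<open>omega\<close>, a gradient of \<open>L y\<close> at \<open>x\<close> of local dual norm
  at most \<open>t \<kappa>\<close> with \<open>\<kappa> < 1\<close> implies \<open>d y \<le> L y x + t omega_star \<kappa>\<close> (lemma \<open>lagrangian_smoothed_le\<close>).
  For the current multiplier \<open>\<kappa> = \<delta>\<close> serves. For the next multiplier the gradient at the same point
  \<open>x\<close> changes by the Newton step, whose local dual norm is \<open>t \<alpha> l\<close> for step size \<open>\<alpha>\<close> and
  decrement \<open>l\<close>; so \<open>\<kappa> = u = \<alpha> l + \<delta>\<close> serves, and \<open>L\<close> itself falls by \<open>t \<alpha> l\<^sup>2\<close>. The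
  prescribed \<open>\<alpha>\<close> solves \<open>\<alpha> l\<^sup>2 = u\<^sup>2 / (1 - u)\<close>, and for such \<open>u\<close> the net decrease
  \<open>t (\<alpha> l\<^sup>2 - omega_star u)\<close> equals \<open>t omega (u / (1 - u))\<close>, with \<open>u / (1 - u)\<close> the value of
  \<open>eta_lower\<close> at \<open>l\<close> (lemmas \<open>step_equation\<close> and \<open>damped_newton_step_descent\<close>). This value increases
  with \<open>l\<close>, and \<open>l > \<beta>\<close> as long as the algorithm runs.

  The algorithm controls the gradient only in the dual norm at the analytic center. The dual
  norm at \<open>x\<close> is larger by at most the factor \<open>2 (\<nu> + 2 sqrt \<nu>)\<close>: the unit ellipsoid at \<open>x\<close> is
  contained in the domain (lemma \<open>Dikin_ellipsoid\<close>), and the domain is contained in the ellipsoid of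
  radius \<open>\<nu> + 2 sqrt \<nu>\<close> around the center (lemma \<open>barrier_outer_ellipsoid\<close>). All of this is shown for
  an arbitrary barrier on a bounded set; the sum of two barriers is a barrier of the product set
  (lemma \<open>self_concordant_barrier_block_sum\<close>). Finally, \<open>\<beta>\<close> is positive because the roots of the
  critical cubic polynomial are nonnegative (lemma \<open>beta_lower_nonneg\<close>).\<close>

section \<open>Gradients and Hessians\<close>

lemma gradient_eqI:
  fixes f :: "'a::real_inner \<Rightarrow> real"
  assumes "(f has_derivative (\<lambda>h. g \<bullet> h)) (at x)"
  shows "gradient f x = g"
  unfolding gradient_def
proof (rule the_equality)
  show "GDERIV f x :> g"
    using assms by (simp add: gderiv_def inner_commute)
next
  fix D assume "GDERIV f x :> D"
  then have "(\<lambda>h. h \<bullet> D) = (\<lambda>h. g \<bullet> h)"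
    using assms has_derivative_unique by (auto simp: gderiv_def)
  then have "h \<bullet> (D - g) = 0" for h
    by (metis inner_commute inner_diff_right right_minus_eq)
  then show "D = g"
    by (metis inner_eq_zero_iff right_minus_eq)
qed

lemma gradient_has_derivative:
  fixes f :: "'a::euclidean_space \<Rightarrow> real"
  assumes "f differentiable (at x)"
  shows "(f has_derivative (\<lambda>h. gradient f x \<bullet> h)) (at x)"
proof -
  obtain f' where f': "(f has_derivative f') (at x)"
    using assms by (auto simp: differentiable_def)
  have "f' h = adjoint f' 1 \<bullet> h" for h
    using adjoint_works[OF has_derivative_linear[OF f'], of h 1] by (simp add: inner_commute)
  then have "f' = (\<lambda>h. adjoint f' 1 \<bullet> h)"
    by blast
  with f' have "(f has_derivative (\<lambda>h. adjoint f' 1 \<bullet> h)) (at x)"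
    by simp
  then show ?thesis
    using gradient_eqI by metis
qed

lemma hessian_eqI:
  assumes "(gradient f has_derivative (\<lambda>h. M *v h)) (at x)"
  shows "hessian f x = M"
  unfolding hessian_def jacobian_def
  by (metis assms frechet_derivative_at matrix_of_matrix_vector_mul)

lemma hessian_has_derivative:
  assumes "gradient f differentiable (at x)"
  shows "(gradient f has_derivative (\<lambda>h. hessian f x *v h)) (at x)"
  using assms unfolding hessian_def jacobian_works .

text \<open>Both sides are the limit of the second difference
  \<open>f (x + s h + s k) - f (x + s h) - f (x + s k) + f x\<close> divided by \<open>s\<^sup>2\<close>, and the second
  difference does not change when \<open>h\<close> and \<open>k\<close> are exchanged.\<close>

lemma second_derivative_symmetric:
  fixes f :: "'a::real_inner \<Rightarrow> real" and g :: "'a \<Rightarrow> 'a"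
  assumes S: "open S" "x \<in> S"
    and f: "\<And>z. z \<in> S \<Longrightarrow> (f has_derivative (\<lambda>h. g z \<bullet> h)) (at z)"
    and g: "(g has_derivative g') (at x)"
  shows "g' h \<bullet> k = g' k \<bullet> h"
proof -
  define \<Delta> where "\<Delta> h k s = f (x + s *\<^sub>R h + s *\<^sub>R k) - f (x + s *\<^sub>R h) - f (x + s *\<^sub>R k) + f x"
    for h k and s :: real
  have lin: "linear g'"
    using g has_derivative_linear by blast
  have key: "\<exists>\<delta>>0. \<forall>s. 0 < s \<longrightarrow> s < \<delta> \<longrightarrow> \<bar>\<Delta> h k s - s\<^sup>2 * (g' h \<bullet> k)\<bar> \<le> e * s\<^sup>2"
    if e: "e > 0" for h k e
  proof -
    define N where "N = norm h + norm k + 1"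
    have N: "N > 0" "norm h \<le> N" "norm k \<le> N" "norm h + norm k < N"
      by (auto simp: N_def add_nonneg_pos)
    \<comment> \<open>The error of the linearization of \<open>g\<close> enters at two points at distance at most \<open>s * N\<close>
      from \<open>x\<close> and is multiplied by \<open>norm k \<le> N\<close>.\<close>
    define e' where "e' = e / (2 * N * N)"
    have e': "e' > 0"
      using e N by (simp add: e'_def)
    obtain d1 where d1: "d1 > 0"
      "\<And>z. norm (z - x) < d1 \<Longrightarrow> norm (g z - g x - g' (z - x)) \<le> e' * norm (z - x)"
      using g e' unfolding has_derivative_at_alt by blast
    obtain d2 where d2: "d2 > 0" "ball x d2 \<subseteq> S"
      using S open_contains_ball by blast
    define d where "d = min d1 d2 / N"
    have d: "d > 0"
      using d1 d2 N by (simp add: d_def)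
    have "\<bar>\<Delta> h k s - s\<^sup>2 * (g' h \<bullet> k)\<bar> \<le> e * s\<^sup>2" if s: "0 < s" "s < d" for s
    proof -
      have sN: "s * N < min d1 d2"
        using s N unfolding d_def by (simp add: pos_less_divide_eq)
      have small: "norm (\<sigma> *\<^sub>R h + \<tau> *\<^sub>R k) \<le> s * N"
        if "0 \<le> \<sigma>" "\<sigma> \<le> s" "0 \<le> \<tau>" "\<tau> \<le> s" for \<sigma> \<tau>
      proof -
        have "norm (\<sigma> *\<^sub>R h + \<tau> *\<^sub>R k) \<le> \<sigma> * norm h + \<tau> * norm k"
          using norm_triangle_ineq[of "\<sigma> *\<^sub>R h" "\<tau> *\<^sub>R k"] that by simp
        also have "\<dots> \<le> s * norm h + s * norm k"
          using that by (intro add_mono mult_right_mono) auto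
        also have "\<dots> \<le> s * N"
          using s N by (simp add: distrib_left[symmetric])
        finally show ?thesis .
      qed
      have inS: "x + \<sigma> *\<^sub>R h + \<tau> *\<^sub>R k \<in> S"
        if "0 \<le> \<sigma>" "\<sigma> \<le> s" "0 \<le> \<tau>" "\<tau> \<le> s" for \<sigma> \<tau>
      proof -
        have "dist x (x + \<sigma> *\<^sub>R h + \<tau> *\<^sub>R k) = norm (\<sigma> *\<^sub>R h + \<tau> *\<^sub>R k)"
          by (metis add.assoc add_diff_cancel_left' dist_commute dist_norm)
        then show ?thesis
          using small[OF that] sN d2 by auto
      qed
      define p where "p \<tau> = f (x + s *\<^sub>R h + \<tau> *\<^sub>R k) - f (x + 0 *\<^sub>R h + \<tau> *\<^sub>R k)" for \<tau>
      have der: "DERIV (\<lambda>\<tau>. f (x + \<sigma> *\<^sub>R h + \<tau> *\<^sub>R k)) \<tau> :> g (x + \<sigma> *\<^sub>R h + \<tau> *\<^sub>R k) \<bullet> k"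
        if "0 \<le> \<sigma>" "\<sigma> \<le> s" "0 \<le> \<tau>" "\<tau> \<le> s" for \<sigma> \<tau>
      proof -
        have 1: "((\<lambda>\<tau>. x + \<sigma> *\<^sub>R h + \<tau> *\<^sub>R k) has_derivative (\<lambda>r. r *\<^sub>R k)) (at \<tau>)"
          by (auto intro!: derivative_eq_intros)
        have "((\<lambda>\<tau>. f (x + \<sigma> *\<^sub>R h + \<tau> *\<^sub>R k)) has_derivative
            (\<lambda>r. g (x + \<sigma> *\<^sub>R h + \<tau> *\<^sub>R k) \<bullet> (r *\<^sub>R k))) (at \<tau>)"
          using has_derivative_compose[OF 1 f[OF inS[OF that]]] .
        then show ?thesis
          by (simp add: has_field_derivative_def mult.commute[of _ "g _ \<bullet> k"] mult_commute_abs)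
      qed
      have "DERIV p \<tau> :> g (x + s *\<^sub>R h + \<tau> *\<^sub>R k) \<bullet> k - g (x + 0 *\<^sub>R h + \<tau> *\<^sub>R k) \<bullet> k"
        if "0 \<le> \<tau>" "\<tau> \<le> s" for \<tau>
        unfolding p_def using s that by (intro DERIV_diff der) auto
      from MVT2[OF s(1) this] obtain \<theta> where \<theta>: "0 < \<theta>" "\<theta> < s"
        "p s - p 0 = s * (g (x + s *\<^sub>R h + \<theta> *\<^sub>R k) \<bullet> k - g (x + 0 *\<^sub>R h + \<theta> *\<^sub>R k) \<bullet> k)"
        by auto
      define R where "R \<sigma> = g (x + \<sigma> *\<^sub>R h + \<theta> *\<^sub>R k) - g x - g' (\<sigma> *\<^sub>R h + \<theta> *\<^sub>R k)" for \<sigma>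
      have R: "norm (R \<sigma>) \<le> e' * (s * N)" if "0 \<le> \<sigma>" "\<sigma> \<le> s" for \<sigma>
      proof -
        have "norm (\<sigma> *\<^sub>R h + \<theta> *\<^sub>R k) \<le> s * N"
          using small that \<theta> by simp
        moreover have "norm (R \<sigma>) \<le> e' * norm (\<sigma> *\<^sub>R h + \<theta> *\<^sub>R k)"
          using d1(2)[of "x + \<sigma> *\<^sub>R h + \<theta> *\<^sub>R k"] sN calculation
          by (simp add: R_def add.assoc)
        ultimately show ?thesis
          using e' by (meson mult_left_mono order_trans less_imp_le)
      qed
      have "p s - p 0 = s * ((s *\<^sub>R g' h + (R s - R 0)) \<bullet> k)"
        unfolding \<theta>(3) R_def
        by (simp add: linear_add[OF lin] linear_scale[OF lin] inner_diff_left inner_add_left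
            algebra_simps)
      then have "\<Delta> h k s - s\<^sup>2 * (g' h \<bullet> k) = s * ((R s - R 0) \<bullet> k)"
        by (simp add: \<Delta>_def p_def inner_add_left algebra_simps power2_eq_square)
      also have "\<bar>\<dots>\<bar> \<le> s * ((2 * e' * (s * N)) * N)"
      proof -
        have "norm (R s - R 0) \<le> 2 * e' * (s * N)"
          using R[of s] R[of 0] s norm_triangle_ineq4[of "R s" "R 0"] by auto
        then have "norm (R s - R 0) * norm k \<le> (2 * e' * (s * N)) * N"
          using N e' s by (intro mult_mono) auto
        then show ?thesis
          using s Cauchy_Schwarz_ineq2[of "R s - R 0" k] by (auto simp: abs_mult)
      qed
      also have "\<dots> = e * s\<^sup>2"
        using N by (simp add: e'_def field_simps power2_eq_square)
      finally show ?thesis .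
    qed
    with d show ?thesis
      by blast
  qed
  have "\<bar>g' h \<bullet> k - g' k \<bullet> h\<bar> \<le> e" if e: "e > 0" for e
  proof -
    obtain \<delta>1 where \<delta>1: "\<delta>1 > 0"
      "\<And>s. 0 < s \<Longrightarrow> s < \<delta>1 \<Longrightarrow> \<bar>\<Delta> h k s - s\<^sup>2 * (g' h \<bullet> k)\<bar> \<le> (e / 2) * s\<^sup>2"
      using key[of "e / 2" h k] e by auto
    obtain \<delta>2 where \<delta>2: "\<delta>2 > 0"
      "\<And>s. 0 < s \<Longrightarrow> s < \<delta>2 \<Longrightarrow> \<bar>\<Delta> k h s - s\<^sup>2 * (g' k \<bullet> h)\<bar> \<le> (e / 2) * s\<^sup>2"
      using key[of "e / 2" k h] e by auto
    define s where "s = min \<delta>1 \<delta>2 / 2"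
    have s: "0 < s" "s < \<delta>1" "s < \<delta>2"
      using \<delta>1 \<delta>2 by (auto simp: s_def)
    have "\<Delta> h k s = \<Delta> k h s"
      by (simp add: \<Delta>_def algebra_simps)
    then have "\<bar>s\<^sup>2 * (g' h \<bullet> k) - s\<^sup>2 * (g' k \<bullet> h)\<bar> \<le> e * s\<^sup>2"
      using \<delta>1(2)[OF s(1,2)] \<delta>2(2)[OF s(1,3)] by linarith
    then have "s\<^sup>2 * \<bar>g' h \<bullet> k - g' k \<bullet> h\<bar> \<le> s\<^sup>2 * e"
      by (metis abs_mult abs_power2 mult.commute right_diff_distrib)
    then show ?thesis
      using s by simp
  qed
  then have "\<bar>g' h \<bullet> k - g' k \<bullet> h\<bar> \<le> 0"
    by (rule field_le_epsilon) simp
  then show ?thesis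
    by simp
qed

section \<open>Symmetric positive definite matrices\<close>

definition spd :: "real^'n^'n \<Rightarrow> bool" where
  "spd M \<longleftrightarrow> (\<forall>u v. u \<bullet> (M *v v) = v \<bullet> (M *v u)) \<and> (\<forall>u. u \<noteq> 0 \<longrightarrow> 0 < u \<bullet> (M *v u))"

lemma spd_sym: "spd M \<Longrightarrow> u \<bullet> (M *v v) = v \<bullet> (M *v u)"
  by (simp add: spd_def)

lemma spd_nonneg: "spd M \<Longrightarrow> 0 \<le> u \<bullet> (M *v u)"
  by (cases "u = 0") (auto simp: spd_def less_imp_le)

lemma spd_invertible:
  fixes M :: "real^'n^'n"
  assumes "spd M"
  shows "M *v (matrix_inv M *v u) = u"
proof -
  have "\<forall>x. M *v x = 0 \<longrightarrow> x = 0"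
    using assms unfolding spd_def by (metis inner_zero_right less_irrefl)
  then have "invertible M"
    by (simp add: invertible_left_inverse matrix_left_invertible_ker)
  then have "M ** matrix_inv M = mat 1"
    unfolding matrix_inv_def invertible_def by (rule someI2_ex) blast
  then show ?thesis
    by (simp add: matrix_vector_mul_assoc)
qed

lemma spd_matrix_inv:
  fixes M :: "real^'n^'n"
  assumes "spd M"
  shows "spd (matrix_inv M)"
  unfolding spd_def
proof (intro conjI allI impI)
  fix u v :: "real^'n"
  let ?u = "matrix_inv M *v u" and ?v = "matrix_inv M *v v"
  have "u \<bullet> ?v = (M *v ?u) \<bullet> ?v"
    using spd_invertible[OF assms] by simp
  also have "\<dots> = ?u \<bullet> (M *v ?v)"
    using spd_sym[OF assms] by (simp add: inner_commute)
  also have "\<dots> = v \<bullet> ?u"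
    using spd_invertible[OF assms] by (simp add: inner_commute)
  finally show "u \<bullet> ?v = v \<bullet> ?u" .
next
  fix u :: "real^'n" assume "u \<noteq> 0"
  let ?u = "matrix_inv M *v u"
  have "M *v ?u = u"
    using spd_invertible[OF assms] .
  moreover from this have "?u \<noteq> 0"
    using \<open>u \<noteq> 0\<close> by (metis matrix_vector_mult_0_right)
  ultimately show "0 < u \<bullet> ?u"
    using assms unfolding spd_def by (metis inner_commute)
qed

text \<open>The Cauchy-Schwarz inequality of the inner product \<open>M\<close>, with \<open>u\<close> written as
  \<open>M v\<close>: the form is nonnegative at \<open>(h \<bullet> M h) v - (u \<bullet> h) h\<close>.\<close>

lemma spd_Cauchy_Schwarz:
  assumes "spd M"
  shows "\<bar>u \<bullet> h\<bar> \<le> sqrt (u \<bullet> (matrix_inv M *v u)) * sqrt (h \<bullet> (M *v h))"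
proof (cases "h = 0")
  case False
  define v where "v = matrix_inv M *v u"
  define a where "a = h \<bullet> (M *v h)"
  define w where "w = u \<bullet> h"
  define q where "q = u \<bullet> v"
  have Mv: "M *v v = u"
    by (simp add: v_def spd_invertible[OF assms])
  have a: "a > 0"
    using assms False by (simp add: spd_def a_def)
  have vMh: "v \<bullet> (M *v h) = w"
    using spd_sym[OF assms, of v h] by (simp add: Mv w_def inner_commute)
  have "0 \<le> (a *\<^sub>R v - w *\<^sub>R h) \<bullet> (M *v (a *\<^sub>R v - w *\<^sub>R h))"
    by (rule spd_nonneg[OF assms])
  also have "\<dots> = a * a * q - a * w * w - w * a * w + w * w * a"
    unfolding matrix_vector_mult_diff_distrib matrix_vector_mult_scaleR Mv
    using vMh by (simp add: inner_diff_left inner_diff_right q_def a_def w_def inner_commute algebra_simps)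
  also have "\<dots> = a * (q * a - w\<^sup>2)"
    by (simp add: algebra_simps power2_eq_square)
  finally have "w\<^sup>2 \<le> q * a"
    using a by (simp add: zero_le_mult_iff)
  then have "\<bar>w\<bar> \<le> sqrt (q * a)"
    using real_sqrt_le_mono by fastforce
  then show ?thesis
    by (simp add: real_sqrt_mult w_def q_def a_def v_def)
qed simp

lemma spd_congruence:
  fixes A :: "real^'n^'m"
  assumes "spd M" and A: "rank A = CARD('m)"
  shows "spd (A ** M ** transpose A)"
proof -
  have eq: "u \<bullet> ((A ** M ** transpose A) *v v) = (transpose A *v u) \<bullet> (M *v (transpose A *v v))"
    for u v
  proof -
    have "u \<bullet> (A *v w) = (transpose A *v u) \<bullet> w" for w
      by (metis dot_lmul_matrix transpose_matrix_vector)
    then show ?thesis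
      by (simp add: matrix_vector_mul_assoc[symmetric] del: transpose_matrix_vector)
  qed
  have "inj ((*v) (transpose A))"
    using A by (metis full_rank_injective rank_transpose)
  then have "transpose A *v u \<noteq> 0" if "u \<noteq> 0" for u
    using that by (metis injD matrix_vector_mult_0_right)
  then show ?thesis
    using assms(1) unfolding spd_def eq by (metis spd_sym)
qed

lemma spd_scaleR: "spd M \<Longrightarrow> 0 < t \<Longrightarrow> spd (t *\<^sub>R M)"
  by (simp add: spd_def scaleR_matrix_vector_assoc[symmetric])

section \<open>Self-concordant functions on lines\<close>

lemma linear_line_derivative:
  fixes x h :: "'a::real_normed_vector"
  shows "((\<lambda>s. x + s *\<^sub>R h) has_derivative (\<lambda>r. r *\<^sub>R h)) (at s)"
  by (auto intro!: derivative_eq_intros)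

lemma differentiable_on_open_at:
  "f differentiable_on S \<Longrightarrow> open S \<Longrightarrow> x \<in> S \<Longrightarrow> f differentiable (at x)"
  by (metis at_within_open differentiable_on_def)

lemma DERIV_line:
  fixes f :: "'a::euclidean_space \<Rightarrow> real"
  assumes "f differentiable (at (x + s *\<^sub>R h))"
  shows "DERIV (\<lambda>s. f (x + s *\<^sub>R h)) s :> gradient f (x + s *\<^sub>R h) \<bullet> h"
  using has_derivative_compose[OF linear_line_derivative gradient_has_derivative[OF assms]]
  by (simp add: has_field_derivative_def mult.commute[of _ "gradient f _ \<bullet> h"] mult_commute_abs)

lemma DERIV_gradient_line:
  fixes f :: "real^'n \<Rightarrow> real"
  assumes "gradient f differentiable (at (x + s *\<^sub>R h))"
  shows "DERIV (\<lambda>s. gradient f (x + s *\<^sub>R h) \<bullet> h) s :> h \<bullet> (hessian f (x + s *\<^sub>R h) *v h)"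
proof -
  have "((\<lambda>s. gradient f (x + s *\<^sub>R h)) has_derivative
      (\<lambda>r. hessian f (x + s *\<^sub>R h) *v (r *\<^sub>R h))) (at s)"
    using has_derivative_compose[OF linear_line_derivative hessian_has_derivative[OF assms]] .
  from has_derivative_inner_left[OF this, of h] show ?thesis
    by (simp add: has_field_derivative_def matrix_vector_mult_scaleR inner_commute
        mult.commute[of _ "h \<bullet> _"] mult_commute_abs)
qed

lemma bounded_linear_matrix_form: "bounded_linear (\<lambda>M :: real^'n^'m. u \<bullet> (M *v v))"
  by (intro linear_conv_bounded_linear[THEN iffD1] linearI)
     (auto simp: matrix_vector_mult_add_rdistrib inner_add_right scaleR_matrix_vector_assoc[symmetric])

lemma DERIV_hessian_line:
  fixes f :: "real^'n \<Rightarrow> real"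
  assumes "hessian f differentiable (at (x + s *\<^sub>R h))"
  shows "DERIV (\<lambda>s. h \<bullet> (hessian f (x + s *\<^sub>R h) *v h)) s :> third_diff f (x + s *\<^sub>R h) h"
proof -
  let ?D = "frechet_derivative (hessian f) (at (x + s *\<^sub>R h))"
  have D: "(hessian f has_derivative ?D) (at (x + s *\<^sub>R h))"
    using assms frechet_derivative_works by blast
  have "((\<lambda>s. hessian f (x + s *\<^sub>R h)) has_derivative (\<lambda>r. ?D (r *\<^sub>R h))) (at s)"
    using has_derivative_compose[OF linear_line_derivative D] .
  from bounded_linear.has_derivative[OF bounded_linear_matrix_form this, of h h] show ?thesis
    by (simp add: has_field_derivative_def third_diff_def linear_scale[OF has_derivative_linear[OF D]]
        scaleR_matrix_vector_assoc[symmetric] mult.commute[of _ "h \<bullet> _"] mult_commute_abs)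
qed

lemma self_concordant_onD:
  fixes f :: "real^'n \<Rightarrow> real"
  assumes "self_concordant_on S f" "open S" "x \<in> S"
  shows "f differentiable (at x)" "gradient f differentiable (at x)" "hessian f differentiable (at x)"
    "\<bar>third_diff f x h\<bar> \<le> 2 * (h \<bullet> (hessian f x *v h)) powr (3/2)"
  using assms differentiable_on_open_at unfolding self_concordant_on_def C3_on_def by blast+

lemma self_concordant_hessian_symmetric:
  fixes f :: "real^'n \<Rightarrow> real"
  assumes sc: "self_concordant_on S f" "open S" "x \<in> S"
  shows "u \<bullet> (hessian f x *v v) = v \<bullet> (hessian f x *v u)"
  using second_derivative_symmetric[OF sc(2,3) gradient_has_derivative
      hessian_has_derivative[OF self_concordant_onD(2)[OF sc]], of v u]
  using self_concordant_onD(1)[OF sc(1,2)] by (simp add: inner_commute)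

lemma eventually_line_in_open:
  fixes x h :: "'a::real_normed_vector"
  assumes "open S" "x \<in> S"
  shows "\<forall>\<^sub>F s in nhds 0. x + s *\<^sub>R h \<in> S"
proof -
  have "((\<lambda>s. x + s *\<^sub>R h) \<longlongrightarrow> x + 0 *\<^sub>R h) (nhds 0)"
    by (intro tendsto_intros) (simp add: filterlim_ident)
  then show ?thesis
    using topological_tendstoD[OF _ assms(1)] assms(2) by fastforce
qed

text \<open>The slope at \<open>x\<close> is the limit of difference quotients, and by convexity all of them are at most
  \<open>f z - f x\<close>.\<close>

lemma convex_above_tangent:
  fixes f :: "'a::euclidean_space \<Rightarrow> real"
  assumes f: "convex_on S f" and x: "x \<in> S" "f differentiable (at x)" and z: "z \<in> S"
  shows "f x + gradient f x \<bullet> (z - x) \<le> f z"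
proof -
  let ?q = "\<lambda>s. (f (x + s *\<^sub>R (z - x)) - f x) / s"
  have "DERIV (\<lambda>s. f (x + s *\<^sub>R (z - x))) 0 :> gradient f x \<bullet> (z - x)"
    using DERIV_line[of f x 0 "z - x"] x by simp
  then have "(?q \<longlongrightarrow> gradient f x \<bullet> (z - x)) (at_right 0)"
    by (auto simp: has_field_derivative_iff intro: tendsto_within_subset)
  moreover have "\<forall>\<^sub>F s in at_right 0. ?q s \<le> f z - f x"
  proof -
    have "?q s \<le> f z - f x" if "0 < s" "s < 1" for s
    proof -
      have "x + s *\<^sub>R (z - x) = (1 - s) *\<^sub>R x + s *\<^sub>R z"
        by (simp add: algebra_simps)
      then have "f (x + s *\<^sub>R (z - x)) \<le> (1 - s) * f x + s * f z"
        using convex_onD[OF f, of s x z] that x z by simp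
      then have "f (x + s *\<^sub>R (z - x)) - f x \<le> s * (f z - f x)"
        by (simp add: algebra_simps)
      then show ?thesis
        using that by (simp add: pos_divide_le_eq mult.commute)
    qed
    then show ?thesis
      unfolding eventually_at_right_field by (intro exI[of _ 1]) auto
  qed
  ultimately have "gradient f x \<bullet> (z - x) \<le> f z - f x"
    using tendsto_upperbound trivial_limit_at_right_real by blast
  then show ?thesis
    by simp
qed

text \<open>The tangent inequalities at \<open>x\<close> and at \<open>x + s h\<close> together say that the slope in direction \<open>h\<close>
  does not decrease.\<close>

lemma self_concordant_hessian_nonneg:
  fixes f :: "real^'n \<Rightarrow> real"
  assumes sc: "self_concordant_on S f" "open S" "x \<in> S"
  shows "0 \<le> h \<bullet> (hessian f x *v h)"
proof -
  let ?p = "\<lambda>s. gradient f (x + s *\<^sub>R h) \<bullet> h"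
  have f: "convex_on S f"
    using sc by (simp add: self_concordant_on_def)
  have "DERIV ?p 0 :> h \<bullet> (hessian f x *v h)"
    using DERIV_gradient_line[of f x 0 h] self_concordant_onD(2)[OF sc] by simp
  then have "((\<lambda>s. (?p s - ?p 0) / s) \<longlongrightarrow> h \<bullet> (hessian f x *v h)) (at_right 0)"
    by (auto simp: has_field_derivative_iff intro: tendsto_within_subset)
  moreover have "\<forall>\<^sub>F s in at_right 0. 0 \<le> (?p s - ?p 0) / s"
  proof -
    have "\<forall>\<^sub>F s in at_right 0. x + s *\<^sub>R h \<in> S"
      using eventually_line_in_open[OF sc(2,3)] by (rule filter_leD[OF at_within_le_nhds])
    moreover have "\<forall>\<^sub>F s :: real in at_right 0. 0 < s"
      by (simp add: eventually_at_right_less)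
    ultimately show ?thesis
    proof eventually_elim
      case (elim s)
      let ?z = "x + s *\<^sub>R h"
      have "f x + gradient f x \<bullet> (?z - x) \<le> f ?z" "f ?z + gradient f ?z \<bullet> (x - ?z) \<le> f x"
        using convex_above_tangent[OF f] sc(3) elim(1) self_concordant_onD(1)[OF sc(1,2)] by blast+
      then have "0 \<le> s * (?p s - ?p 0)"
        by (simp add: algebra_simps)
      then show ?case
        using elim(2) by (simp add: zero_le_mult_iff)
    qed
  qed
  ultimately show ?thesis
    using tendsto_lowerbound trivial_limit_at_right_real by blast
qed

text \<open>Along a line, self-concordance says that \<open>\<phi>'' powr (- 1/2)\<close> is 1-Lipschitz. The shift by
  \<open>e > 0\<close> keeps the power differentiable where \<open>\<phi>''\<close> vanishes.\<close>

lemma self_concordant_inverse_sqrt_Lipschitz: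
  fixes p p' :: "real \<Rightarrow> real"
  assumes e: "0 < e" and a: "0 \<le> a"
    and der: "\<And>s. 0 \<le> s \<Longrightarrow> s \<le> a \<Longrightarrow> DERIV p s :> p' s"
    and nonneg: "\<And>s. 0 \<le> s \<Longrightarrow> s \<le> a \<Longrightarrow> 0 \<le> p s"
    and sc: "\<And>s. 0 \<le> s \<Longrightarrow> s \<le> a \<Longrightarrow> \<bar>p' s\<bar> \<le> 2 * p s powr (3/2)"
  shows "\<bar>1 / sqrt (p a + e) - 1 / sqrt (p 0 + e)\<bar> \<le> a"
proof (cases "a = 0")
  case False
  define q where "q s = - p' s / (2 * (p s + e) * sqrt (p s + e))" for s
  have pos: "0 < p s + e" if "0 \<le> s" "s \<le> a" for s
    using nonneg[OF that] e by simp
  have q: "DERIV (\<lambda>s. 1 / sqrt (p s + e)) s :> q s" if "0 \<le> s" "s \<le> a" for s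
  proof -
    have "DERIV (\<lambda>s. sqrt (p s + e)) s :> p' s / (2 * sqrt (p s + e))"
      using pos[OF that] der[OF that]
      by (auto intro!: derivative_eq_intros simp: field_simps)
    then have "DERIV (\<lambda>s. inverse (sqrt (p s + e))) s :>
        - (inverse (sqrt (p s + e)) * (p' s / (2 * sqrt (p s + e))) * inverse (sqrt (p s + e)))"
      using pos[OF that] by (intro DERIV_inverse') auto
    moreover have "- (inverse (sqrt (p s + e)) * (p' s / (2 * sqrt (p s + e))) * inverse (sqrt (p s + e))) = q s"
      using pos[OF that] by (simp add: q_def divide_simps)
    ultimately show ?thesis
      by (simp add: inverse_eq_divide)
  qed
  have bd: "\<bar>q s\<bar> \<le> 1" if "0 \<le> s" "s \<le> a" for s
  proof -
    have "\<bar>p' s\<bar> \<le> 2 * (p s + e) powr (3/2)"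
      using sc[OF that] nonneg[OF that] e powr_mono2[of "3/2" "p s" "p s + e"] by simp
    also have "(p s + e) powr (3/2) = (p s + e) * sqrt (p s + e)"
      using pos[OF that] powr_add[of "p s + e" 1 "1/2"] by (simp add: powr_half_sqrt)
    finally have "\<bar>p' s\<bar> \<le> 2 * (p s + e) * sqrt (p s + e)"
      by (simp only: mult.assoc)
    moreover have d: "0 < 2 * (p s + e) * sqrt (p s + e)"
      using pos[OF that] by simp
    ultimately show ?thesis
      by (simp only: q_def abs_divide abs_minus_cancel abs_of_pos[OF d] divide_le_eq_1_pos[OF d])
  qed
  obtain s where s: "0 < s" "s < a"
      "1 / sqrt (p a + e) - 1 / sqrt (p 0 + e) = (a - 0) * q s"
    using MVT2[of 0 a "\<lambda>s. 1 / sqrt (p s + e)" q] q False a by auto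
  then show ?thesis
    using bd[of s] a by (simp add: abs_mult mult_left_le)
qed simp

text \<open>The Lipschitz bound for the shift \<open>e\<close> gives \<open>1 / sqrt (p a + e) \<le> 1 / sqrt (p 0) + a\<close>, whose
  right-hand side is free of \<open>e\<close>; so \<open>e\<close> may tend to 0.\<close>

lemma self_concordant_second_derivative_lower:
  fixes p p' :: "real \<Rightarrow> real"
  assumes a: "0 \<le> a"
    and der: "\<And>s. 0 \<le> s \<Longrightarrow> s \<le> a \<Longrightarrow> DERIV p s :> p' s"
    and nonneg: "\<And>s. 0 \<le> s \<Longrightarrow> s \<le> a \<Longrightarrow> 0 \<le> p s"
    and sc: "\<And>s. 0 \<le> s \<Longrightarrow> s \<le> a \<Longrightarrow> \<bar>p' s\<bar> \<le> 2 * p s powr (3/2)"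
  shows "p 0 / (1 + a * sqrt (p 0))\<^sup>2 \<le> p a"
proof (cases "p 0 = 0")
  case True
  then show ?thesis
    using nonneg[of a] a by simp
next
  case False
  define r where "r = sqrt (p 0)"
  have r: "0 < r" "p 0 = r\<^sup>2"
    using False nonneg[of 0] a by (auto simp: r_def)
  have "r\<^sup>2 / (1 + a * r)\<^sup>2 \<le> p a + e" if e: "0 < e" for e
  proof -
    have pos: "0 < p a + e"
      using nonneg[of a] a e by simp
    have "1 / sqrt (p a + e) \<le> 1 / sqrt (p 0 + e) + a"
      using self_concordant_inverse_sqrt_Lipschitz[OF e a der nonneg sc] by (simp add: abs_le_iff)
    also have "1 / sqrt (p 0 + e) \<le> 1 / r"
    proof -
      have "r \<le> sqrt (p 0 + e)"
        using e by (simp add: r_def)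
      then show ?thesis
        using r(1) by (simp add: frac_le)
    qed
    finally have "1 / sqrt (p a + e) \<le> (1 + a * r) / r"
      using r(1) by (simp add: add_divide_distrib)
    then have "r \<le> (1 + a * r) * sqrt (p a + e)"
      using r(1) pos by (simp add: divide_simps mult.commute)
    moreover have "0 < 1 + a * r"
      using r(1) a by (simp add: add_pos_nonneg)
    ultimately have "r / (1 + a * r) \<le> sqrt (p a + e)"
      by (simp add: pos_divide_le_eq mult.commute)
    moreover have "0 \<le> r / (1 + a * r)"
      using r(1) a by simp
    ultimately have "(r / (1 + a * r))\<^sup>2 \<le> (sqrt (p a + e))\<^sup>2"
      by (intro power_mono)
    then show ?thesis
      using pos by (simp add: power_divide)
  qed
  then have "r\<^sup>2 / (1 + a * r)\<^sup>2 \<le> p a"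
    by (rule field_le_epsilon)
  then show ?thesis
    using nonneg[of 0] a by (simp add: r_def)
qed

text \<open>Integrating the lower bound on the second derivative once and twice.\<close>

lemma self_concordant_line_lower:
  fixes \<phi> p q q' :: "real \<Rightarrow> real"
  assumes \<phi>: "\<And>s. 0 \<le> s \<Longrightarrow> s \<le> 1 \<Longrightarrow> DERIV \<phi> s :> p s"
    and p: "\<And>s. 0 \<le> s \<Longrightarrow> s \<le> 1 \<Longrightarrow> DERIV p s :> q s"
    and q: "\<And>s. 0 \<le> s \<Longrightarrow> s \<le> 1 \<Longrightarrow> DERIV q s :> q' s"
    and nonneg: "\<And>s. 0 \<le> s \<Longrightarrow> s \<le> 1 \<Longrightarrow> 0 \<le> q s"
    and sc: "\<And>s. 0 \<le> s \<Longrightarrow> s \<le> 1 \<Longrightarrow> \<bar>q' s\<bar> \<le> 2 * q s powr (3/2)"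
  defines "r \<equiv> sqrt (q 0)"
  shows "p 0 + r\<^sup>2 / (1 + r) \<le> p 1" and "\<phi> 0 + p 0 + omega r \<le> \<phi> 1"
proof -
  have r: "0 \<le> r" "r\<^sup>2 = q 0"
    using nonneg[of 0] by (auto simp: r_def)
  have pos: "0 < 1 + r * s" if "0 \<le> s" for s
    using r that by (simp add: add_pos_nonneg)
  have lower: "r\<^sup>2 / (1 + r * s)\<^sup>2 \<le> q s" if "0 \<le> s" "s \<le> 1" for s
    using self_concordant_second_derivative_lower[of s q q'] that q nonneg sc
    by (simp add: r(2) r_def mult.commute)
  have p_lower: "p 0 + r - r / (1 + r * s) \<le> p s" if s: "0 \<le> s" "s \<le> 1" for s
  proof -
    have "p 0 + r / (1 + r * 0) \<le> p s + r / (1 + r * s)"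
    proof (rule DERIV_nonneg_imp_nondecreasing[OF s(1), where f = "\<lambda>s. p s + r / (1 + r * s)"])
      fix u assume u: "0 \<le> u" "u \<le> s"
      have "DERIV (\<lambda>s. p s + r / (1 + r * s)) u :> q u - r\<^sup>2 / (1 + r * u)\<^sup>2"
        using pos[OF u(1)] p[of u] u s
        by (auto intro!: derivative_eq_intros simp: power2_eq_square)
      then show "\<exists>y. DERIV (\<lambda>s. p s + r / (1 + r * s)) u :> y \<and> 0 \<le> y"
        using lower[of u] u s by auto
    qed
    then show ?thesis
      by simp
  qed
  from p_lower[of 1] show "p 0 + r\<^sup>2 / (1 + r) \<le> p 1"
    using pos[of 1] by (simp add: field_simps power2_eq_square)
  define w where "w s = \<phi> s - (p 0 + r) * s + ln (1 + r * s)" for s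
  have "w 0 \<le> w 1"
  proof (rule DERIV_nonneg_imp_nondecreasing[of 0 1 w])
    fix u :: real assume u: "0 \<le> u" "u \<le> 1"
    have "DERIV w u :> p u - (p 0 + r) + r / (1 + r * u)"
      unfolding w_def using pos[OF u(1)] \<phi>[of u] u by (auto intro!: derivative_eq_intros)
    then show "\<exists>y. DERIV w u :> y \<and> 0 \<le> y"
      using p_lower[OF u] by (intro exI[of _ "p u - (p 0 + r) + r / (1 + r * u)"]) auto
  qed simp
  then show "\<phi> 0 + p 0 + omega r \<le> \<phi> 1"
    by (simp add: omega_def w_def)
qed

section \<open>Local geometry of self-concordant barriers\<close>

definition local_norm :: "(real^'n \<Rightarrow> real) \<Rightarrow> real^'n \<Rightarrow> real^'n \<Rightarrow> real" where
  "local_norm f x h = sqrt (h \<bullet> (hessian f x *v h))"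

lemma local_norm_scaleR: "local_norm f x (s *\<^sub>R h) = \<bar>s\<bar> * local_norm f x h"
  by (simp add: local_norm_def matrix_vector_mult_scaleR mult.assoc[symmetric] real_sqrt_mult)

lemma self_concordant_lower_bounds:
  fixes f :: "real^'n \<Rightarrow> real"
  assumes sc: "self_concordant_on S f" "open S" and x: "x \<in> S" and z: "z \<in> S"
  defines "r \<equiv> local_norm f x (z - x)"
  shows "gradient f x \<bullet> (z - x) + r\<^sup>2 / (1 + r) \<le> gradient f z \<bullet> (z - x)"
    and "f x + gradient f x \<bullet> (z - x) + omega r \<le> f z"
proof -
  let ?h = "z - x"
  have "convex S"
    using sc(1) convex_on_imp_convex by (auto simp: self_concordant_on_def)
  then have inS: "x + s *\<^sub>R ?h \<in> S" if "0 \<le> s" "s \<le> 1" for s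
    using convexD_alt[of S x z s] x z that by (simp add: algebra_simps)
  note D = self_concordant_onD[OF sc inS]
  have nonneg: "0 \<le> ?h \<bullet> (hessian f (x + s *\<^sub>R ?h) *v ?h)" if "0 \<le> s" "s \<le> 1" for s
    using self_concordant_hessian_nonneg[OF sc inS[OF that]] .
  note line = self_concordant_line_lower[of "\<lambda>s. f (x + s *\<^sub>R ?h)" "\<lambda>s. gradient f (x + s *\<^sub>R ?h) \<bullet> ?h"
      "\<lambda>s. ?h \<bullet> (hessian f (x + s *\<^sub>R ?h) *v ?h)" "\<lambda>s. third_diff f (x + s *\<^sub>R ?h) ?h",
      OF DERIV_line[OF D(1)] DERIV_gradient_line[OF D(2)] DERIV_hessian_line[OF D(3)] nonneg D(4)]
  show "gradient f x \<bullet> (z - x) + r\<^sup>2 / (1 + r) \<le> gradient f z \<bullet> (z - x)"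
    using line(1) by (simp add: r_def local_norm_def)
  show "f x + gradient f x \<bullet> (z - x) + omega r \<le> f z"
    using line(2) by (simp add: r_def local_norm_def)
qed

text \<open>A crude counterpart of the lower bounds, uniform in the end point \<open>a \<le> 1\<close>: a function of this
  kind cannot blow up before parameter 1 when its second derivative starts below 1.\<close>

lemma self_concordant_line_upper:
  fixes \<phi> p q q' :: "real \<Rightarrow> real"
  assumes a: "0 \<le> a" "a \<le> 1" and e: "0 < e" "q 0 + e < 1"
    and \<phi>: "\<And>s. 0 \<le> s \<Longrightarrow> s \<le> a \<Longrightarrow> DERIV \<phi> s :> p s"
    and p: "\<And>s. 0 \<le> s \<Longrightarrow> s \<le> a \<Longrightarrow> DERIV p s :> q s"
    and q: "\<And>s. 0 \<le> s \<Longrightarrow> s \<le> a \<Longrightarrow> DERIV q s :> q' s"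
    and nonneg: "\<And>s. 0 \<le> s \<Longrightarrow> s \<le> a \<Longrightarrow> 0 \<le> q s"
    and sc: "\<And>s. 0 \<le> s \<Longrightarrow> s \<le> a \<Longrightarrow> \<bar>q' s\<bar> \<le> 2 * q s powr (3/2)"
  shows "\<phi> a \<le> \<phi> 0 + \<bar>p 0\<bar> + 1 / (1 / sqrt (q 0 + e) - 1)\<^sup>2"
proof -
  define m where "m = 1 / sqrt (q 0 + e) - 1"
  have q0: "0 < q 0 + e"
    using nonneg[of 0] a e by simp
  have m: "0 < m"
    using q0 e by (simp add: m_def)
  have q_le: "q s \<le> 1 / m\<^sup>2" if s: "0 \<le> s" "s \<le> a" for s
  proof -
    have pos: "0 < q s + e"
      using nonneg[OF s] e by simp
    have "\<bar>1 / sqrt (q s + e) - 1 / sqrt (q 0 + e)\<bar> \<le> s"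
      using s by (intro self_concordant_inverse_sqrt_Lipschitz[OF e(1) s(1), of q q'])
        (auto intro: q nonneg sc)
    then have "m \<le> 1 / sqrt (q s + e)"
      using s a by (simp add: m_def abs_le_iff)
    then have "m\<^sup>2 \<le> (1 / sqrt (q s + e))\<^sup>2"
      using m by (intro power_mono) auto
    then have "m\<^sup>2 \<le> 1 / (q s + e)"
      using pos by (simp add: power_divide)
    then have "(q s + e) * m\<^sup>2 \<le> 1"
      using pos by (simp add: pos_le_divide_eq mult.commute)
    moreover have "q s * m\<^sup>2 \<le> (q s + e) * m\<^sup>2"
      using e by (simp add: mult_right_mono)
    ultimately have "q s * m\<^sup>2 \<le> 1"
      by (rule order_trans[rotated])
    then show ?thesis
      using m by (simp add: pos_le_divide_eq)
  qed
  have p_le: "p s \<le> \<bar>p 0\<bar> + 1 / m\<^sup>2" if s: "0 \<le> s" "s \<le> a" for s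
  proof (cases "s = 0")
    case False
    obtain u where u: "0 < u" "u < s" "p s - p 0 = (s - 0) * q u"
      using MVT2[of 0 s p q] False s p by auto
    have "s * q u \<le> 1 * (1 / m\<^sup>2)"
      using u s a q_le[of u] nonneg[of u] by (intro mult_mono) auto
    then show ?thesis
      using u by simp
  qed (use abs_ge_self[of "p 0"] m in \<open>simp add: add_increasing2\<close>)
  show ?thesis
  proof (cases "a = 0")
    case False
    obtain u where u: "0 < u" "u < a" "\<phi> a - \<phi> 0 = (a - 0) * p u"
      using MVT2[of 0 a \<phi> p] False a \<phi> by auto
    have "a * p u \<le> a * (\<bar>p 0\<bar> + 1 / m\<^sup>2)"
      using u a p_le[of u] by (intro mult_left_mono) auto
    also have "\<dots> \<le> \<bar>p 0\<bar> + 1 / m\<^sup>2"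
      using a m by (simp add: mult_left_le_one_le)
    finally show ?thesis
      using u by (simp add: m_def)
  qed simp
qed

lemma self_concordant_barrierD:
  assumes "self_concordant_barrier \<nu> X f"
  shows "self_concordant_on (interior X) f"
    "z \<in> frontier X \<Longrightarrow> filterlim f at_top (at z within interior X)"
    "x \<in> interior X \<Longrightarrow> (gradient f x \<bullet> h)\<^sup>2 \<le> \<nu> * (h \<bullet> (hessian f x *v h))"
  using assms by (auto simp: self_concordant_barrier_def)

text \<open>Dikin's ellipsoid: on the way from \<open>x\<close> to \<open>x + h\<close> the second derivative of \<open>f\<close> stays
  bounded, hence so does \<open>f\<close>, and the barrier cannot be met.\<close>

lemma Dikin_ellipsoid:
  fixes f :: "real^'n \<Rightarrow> real"
  assumes B: "self_concordant_barrier \<nu> X f" and x: "x \<in> interior X" and h: "local_norm f x h < 1"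
  shows "x + h \<in> interior X"
proof (rule ccontr)
  assume out: "x + h \<notin> interior X"
  note sc = self_concordant_barrierD(1)[OF B] open_interior
  have h0: "h \<noteq> 0"
    using out x by auto
  \<comment> \<open>The first parameter \<open>a\<close> at which the segment leaves the interior.\<close>
  define T where "T = {0..1::real} \<inter> (\<lambda>s. x + s *\<^sub>R h) -` (- interior X)"
  have "closed ((\<lambda>s. x + s *\<^sub>R h) -` (- interior X))"
    by (intro closed_vimage) (auto intro!: continuous_intros)
  then have "compact T"
    unfolding T_def by (intro compact_Int_closed) auto
  moreover have "1 \<in> T"
    using out by (simp add: T_def)
  ultimately obtain a where a: "a \<in> T" "\<And>s. s \<in> T \<Longrightarrow> a \<le> s"
    using compact_attains_inf[of T] by auto
  have "a \<noteq> 0"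
    using a(1) x by (auto simp: T_def)
  then have a01: "0 < a" "a \<le> 1"
    using a(1) by (auto simp: T_def)
  have before: "x + s *\<^sub>R h \<in> interior X" if "0 \<le> s" "s < a" for s
    using a(2)[of s] that a01 by (force simp: T_def)
  define z where "z = x + a *\<^sub>R h"
  have ev: "\<forall>\<^sub>F s in at_left a. 0 < s \<and> s < a"
    using eventually_at_left_real[OF a01(1)] by (simp add: greaterThanLessThan_iff)
  have lim: "((\<lambda>s. x + s *\<^sub>R h) \<longlongrightarrow> z) (at_left a)"
    unfolding z_def by (intro tendsto_intros)
  have "z \<in> closure X"
  proof (rule Lim_in_closed_set[OF closed_closure _ _ lim])
    show "\<forall>\<^sub>F s in at_left a. x + s *\<^sub>R h \<in> closure X"
      using ev
    proof eventually_elim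
      case (elim s)
      then show ?case
        using before[of s] interior_subset closure_subset by (auto dest!: subsetD)
    qed
  qed simp
  then have "z \<in> frontier X"
    using a(1) by (simp add: frontier_def T_def z_def)
  from self_concordant_barrierD(2)[OF B this]
  have "filterlim f at_top (at z within interior X)" .
  moreover have "filterlim (\<lambda>s. x + s *\<^sub>R h) (at z within interior X) (at_left a)"
    unfolding filterlim_at
  proof
    show "\<forall>\<^sub>F s in at_left a. x + s *\<^sub>R h \<in> interior X \<and> x + s *\<^sub>R h \<noteq> z"
      using ev by eventually_elim (use before h0 in \<open>auto simp: z_def\<close>)
  qed (rule lim)
  ultimately have unbounded: "filterlim (\<lambda>s. f (x + s *\<^sub>R h)) at_top (at_left a)"
    by (rule filterlim_compose)
  let ?q = "\<lambda>s. h \<bullet> (hessian f (x + s *\<^sub>R h) *v h)"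
  \<comment> \<open>Any shift that keeps \<open>?q 0 + e\<close> below 1 serves; the bound \<open>C\<close> is then the same for all \<open>s < a\<close>.\<close>
  define e where "e = (1 - ?q 0) / 2"
  have q0: "?q 0 < 1"
    using h by (simp add: local_norm_def)
  have e: "0 < e" "?q 0 + e < 1"
    using q0 unfolding e_def by (simp_all add: field_simps)
  define C where "C = f x + \<bar>gradient f x \<bullet> h\<bar> + 1 / (1 / sqrt (?q 0 + e) - 1)\<^sup>2"
  have bounded: "f (x + s *\<^sub>R h) \<le> C" if s: "0 < s" "s < a" for s
  proof -
    have inS: "x + u *\<^sub>R h \<in> interior X" if "0 \<le> u" "u \<le> s" for u
      using before that s by simp
    note D = self_concordant_onD[OF sc inS]
    have "f (x + s *\<^sub>R h) \<le> f (x + 0 *\<^sub>R h) + \<bar>gradient f (x + 0 *\<^sub>R h) \<bullet> h\<bar>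
        + 1 / (1 / sqrt (?q 0 + e) - 1)\<^sup>2"
      by (rule self_concordant_line_upper[of s e ?q "\<lambda>s. f (x + s *\<^sub>R h)"
            "\<lambda>s. gradient f (x + s *\<^sub>R h) \<bullet> h" "\<lambda>s. third_diff f (x + s *\<^sub>R h) h",
            OF _ _ e DERIV_line[OF D(1)] DERIV_gradient_line[OF D(2)] DERIV_hessian_line[OF D(3)]
               self_concordant_hessian_nonneg[OF sc inS] D(4)])
        (use s a01 in auto)
    then show ?thesis
      by (simp add: C_def)
  qed
  have "\<forall>\<^sub>F s in at_left a. C + 1 \<le> f (x + s *\<^sub>R h)"
    using unbounded by (simp add: filterlim_at_top)
  with ev have "\<forall>\<^sub>F s in at_left a. False"
    by eventually_elim (use bounded in force)
  then show False
    by simp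
qed

text \<open>In a direction in which the Hessian degenerates, Dikin's ellipsoid is unbounded.\<close>

lemma barrier_hessian_spd:
  fixes f :: "real^'n \<Rightarrow> real"
  assumes B: "self_concordant_barrier \<nu> X f" and X: "bounded X" and x: "x \<in> interior X"
  shows "spd (hessian f x)"
  unfolding spd_def
proof (intro conjI allI impI)
  note sc = self_concordant_barrierD(1)[OF B] open_interior x
  show "u \<bullet> (hessian f x *v v) = v \<bullet> (hessian f x *v u)" for u v
    by (rule self_concordant_hessian_symmetric[OF sc])
  fix h :: "real^'n" assume h: "h \<noteq> 0"
  show "0 < h \<bullet> (hessian f x *v h)"
  proof (rule ccontr)
    assume "\<not> 0 < h \<bullet> (hessian f x *v h)"
    then have "local_norm f x h = 0"
      using self_concordant_hessian_nonneg[OF sc, of h] by (simp add: local_norm_def)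
    then have all: "x + k *\<^sub>R h \<in> X" for k
      using Dikin_ellipsoid[OF B x, of "k *\<^sub>R h"] interior_subset
      by (auto simp: local_norm_scaleR)
    obtain b where b: "\<And>z. z \<in> X \<Longrightarrow> norm z \<le> b"
      using X bounded_iff by blast
    define k where "k = (2 * b + 1) / norm h"
    have "0 \<le> b"
      using b[OF all[of 0]] norm_ge_zero order_trans by blast
    then have "norm (k *\<^sub>R h) = 2 * b + 1"
      using h by (simp add: k_def)
    moreover have "norm (k *\<^sub>R h) \<le> norm (x + k *\<^sub>R h) + norm x"
      using norm_triangle_ineq4[of "x + k *\<^sub>R h" x] by simp
    ultimately show False
      using b[OF all[of k]] b[OF all[of 0]] by simp
  qed
qed

lemma barrier_local_norm_pos:
  fixes f :: "real^'n \<Rightarrow> real"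
  assumes "self_concordant_barrier \<nu> X f" "bounded X" "x \<in> interior X" "h \<noteq> 0"
  shows "0 < local_norm f x h"
  using barrier_hessian_spd[OF assms(1-3)] assms(4) by (simp add: spd_def local_norm_def)

text \<open>A nonpositive parameter would make the gradient vanish identically, but along a segment of
  positive local length the slope strictly increases.\<close>

lemma barrier_parameter_pos:
  fixes f :: "real^'n \<Rightarrow> real"
  assumes B: "self_concordant_barrier \<nu> X f" and X: "bounded X" and x: "x \<in> interior X"
  shows "0 < \<nu>"
proof (rule ccontr)
  assume \<nu>: "\<not> 0 < \<nu>"
  note sc = self_concordant_barrierD(1)[OF B] open_interior
  have grad0: "gradient f z \<bullet> h = 0" if "z \<in> interior X" for z h
  proof -
    have "\<nu> * (h \<bullet> (hessian f z *v h)) \<le> 0"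
      using \<nu> self_concordant_hessian_nonneg[OF sc that] by (simp add: mult_nonpos_nonneg)
    then have "(gradient f z \<bullet> h)\<^sup>2 \<le> 0"
      using self_concordant_barrierD(3)[OF B that, of h] by linarith
    then show ?thesis
      by simp
  qed
  obtain h0 :: "real^'n" where h0: "h0 \<noteq> 0"
    using SOME_Basis nonzero_Basis by blast
  define h where "h = (1 / (2 * local_norm f x h0)) *\<^sub>R h0"
  have n0: "0 < local_norm f x h0"
    using barrier_local_norm_pos[OF B X x h0] .
  then have half: "local_norm f x h = 1 / 2"
    by (simp add: h_def local_norm_scaleR)
  then have xh: "x + h \<in> interior X"
    by (intro Dikin_ellipsoid[OF B x]) simp
  from self_concordant_lower_bounds(1)[OF sc x xh] show False
    using grad0[OF x] grad0[OF xh] half by (simp add: power2_eq_square)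
qed

text \<open>With \<open>\<phi>\<close> the slope of \<open>f\<close> along the segment from \<open>x\<close> to \<open>z\<close>, the barrier inequality
  reads \<open>\<phi>\<^sup>2 \<le> \<nu> \<phi>'\<close>, that is, \<open>1 / \<phi>\<close> falls at least at rate \<open>1 / \<nu>\<close>. A slope above \<open>\<nu>\<close>
  at \<open>x\<close> would blow up before \<open>z\<close> is reached.\<close>

lemma barrier_slope_le:
  fixes f :: "real^'n \<Rightarrow> real"
  assumes B: "self_concordant_barrier \<nu> X f" and \<nu>: "0 < \<nu>"
    and x: "x \<in> interior X" and z: "z \<in> interior X"
  shows "gradient f x \<bullet> (z - x) \<le> \<nu>"
proof (cases "gradient f x \<bullet> (z - x) \<le> 0")
  case True
  then show ?thesis
    using \<nu> by simp
next
  case False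
  note sc = self_concordant_barrierD(1)[OF B] open_interior
  let ?h = "z - x"
  define p where "p s = gradient f (x + s *\<^sub>R ?h) \<bullet> ?h" for s
  define q where "q s = ?h \<bullet> (hessian f (x + s *\<^sub>R ?h) *v ?h)" for s
  have "convex (interior X)"
    using sc(1) convex_on_imp_convex by (auto simp: self_concordant_on_def)
  then have inS: "x + s *\<^sub>R ?h \<in> interior X" if "0 \<le> s" "s \<le> 1" for s
    using convexD_alt[of "interior X" x z s] x z that by (simp add: algebra_simps)
  have der: "DERIV p s :> q s" if "0 \<le> s" "s \<le> 1" for s
    using DERIV_gradient_line[OF self_concordant_onD(2)[OF sc inS[OF that]]]
    unfolding p_def q_def .
  have bound: "(p s)\<^sup>2 \<le> \<nu> * q s" if "0 \<le> s" "s \<le> 1" for s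
    using self_concordant_barrierD(3)[OF B inS[OF that]] by (simp add: p_def q_def)
  have pos: "0 < p s" if s: "0 \<le> s" "s \<le> 1" for s
  proof -
    have "p 0 \<le> p s"
    proof (rule DERIV_nonneg_imp_nondecreasing[OF s(1)])
      fix u assume "0 \<le> u" "u \<le> s"
      then show "\<exists>y. DERIV p u :> y \<and> 0 \<le> y"
        using der[of u] s self_concordant_hessian_nonneg[OF sc inS, of u ?h] by (auto simp: q_def)
    qed
    then show ?thesis
      using False by (simp add: p_def)
  qed
  have "1 / p 1 + 1 / \<nu> * 1 \<le> 1 / p 0 + 1 / \<nu> * 0"
  proof (rule DERIV_nonpos_imp_nonincreasing[of 0 1 "\<lambda>s. 1 / p s + 1 / \<nu> * s"])
    fix u :: real assume u: "0 \<le> u" "u \<le> 1"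
    have "DERIV (\<lambda>s. 1 / p s + 1 / \<nu> * s) u :> - q u / (p u)\<^sup>2 + 1 / \<nu>"
      using der[OF u] pos[OF u] \<nu>
      by (auto intro!: derivative_eq_intros simp: power2_eq_square)
    moreover have "- q u / (p u)\<^sup>2 + 1 / \<nu> \<le> 0"
      using bound[OF u] pos[OF u] \<nu> by (simp add: field_simps)
    ultimately show "\<exists>y. DERIV (\<lambda>s. 1 / p s + 1 / \<nu> * s) u :> y \<and> y \<le> 0"
      by blast
  qed simp
  moreover have "0 < 1 / p 1"
    using pos[of 1] by simp
  ultimately have "1 / \<nu> \<le> 1 / p 0"
    by linarith
  then have "p 0 \<le> \<nu>"
    using pos[of 0] \<nu> by (simp add: field_simps)
  then show ?thesis
    by (simp add: p_def)
qed

text \<open>Let \<open>v\<close> be the point of the segment at local distance \<open>sqrt \<nu>\<close> from the center \<open>x\<close>. The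
  gradient at \<open>v\<close> gains at least \<open>\<nu> / (1 + sqrt \<nu>)\<close> over \<open>v - x\<close>, because it vanishes at \<open>x\<close>, and
  at most \<open>\<nu>\<close> over \<open>z - v\<close>. As the two differences are parallel, \<open>z - v\<close> is at most
  \<open>1 + sqrt \<nu>\<close> times as long as \<open>v - x\<close>.\<close>

lemma barrier_outer_ellipsoid:
  fixes f :: "real^'n \<Rightarrow> real"
  assumes B: "self_concordant_barrier \<nu> X f" and \<nu>: "0 < \<nu>"
    and x: "x \<in> interior X" and z: "z \<in> interior X" and center: "gradient f x = 0"
  shows "local_norm f x (z - x) \<le> \<nu> + 2 * sqrt \<nu>"
proof (cases "local_norm f x (z - x) \<le> sqrt \<nu>")
  case True
  then show ?thesis
    using \<nu> real_sqrt_gt_zero[OF \<nu>] by linarith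
next
  case False
  note sc = self_concordant_barrierD(1)[OF B] open_interior
  define r where "r = local_norm f x (z - x)"
  define w where "w = sqrt \<nu>"
  have w: "0 < w" "w * w = \<nu>" "w < r"
    using \<nu> False by (auto simp: w_def r_def)
  define \<alpha> where "\<alpha> = w / r"
  have \<alpha>: "0 < \<alpha>" "\<alpha> < 1"
    using w by (auto simp: \<alpha>_def)
  define v where "v = x + \<alpha> *\<^sub>R (z - x)"
  have "convex (interior X)"
    using sc(1) convex_on_imp_convex by (auto simp: self_concordant_on_def)
  then have v: "v \<in> interior X"
    using convexD_alt[of "interior X" x z \<alpha>] x z \<alpha> by (simp add: v_def algebra_simps)
  define g where "g = gradient f v \<bullet> (z - x)"
  have "local_norm f x (v - x) = w"
    using w \<alpha> by (simp add: v_def local_norm_scaleR r_def[symmetric] \<alpha>_def)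
  then have 1: "w * w / (1 + w) \<le> \<alpha> * g"
    using self_concordant_lower_bounds(1)[OF sc x v] center
    by (simp add: v_def g_def power2_eq_square)
  have "z - v = (1 - \<alpha>) *\<^sub>R (z - x)"
    by (simp add: v_def algebra_simps)
  then have 2: "(1 - \<alpha>) * g \<le> w * w"
    using barrier_slope_le[OF B \<nu> v z] w by (simp add: g_def)
  have "(1 - \<alpha>) * (w * w / (1 + w)) \<le> (1 - \<alpha>) * (\<alpha> * g)"
    using \<alpha> by (intro mult_left_mono 1) auto
  also have "\<dots> \<le> \<alpha> * (w * w)"
    using \<alpha> mult_left_mono[OF 2, of \<alpha>] by (simp add: algebra_simps)
  finally have "(w * w) * (1 - \<alpha>) \<le> (w * w) * (\<alpha> * (1 + w))"
    using w by (simp add: pos_divide_le_eq algebra_simps)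
  then have "1 - \<alpha> \<le> \<alpha> * (1 + w)"
    using mult_pos_pos[OF w(1) w(1)] by (simp only: mult_le_cancel_left_pos)
  then have "1 \<le> w * (2 + w) / r"
    by (simp add: \<alpha>_def algebra_simps add_divide_distrib)
  then have "r \<le> w * (2 + w)"
    using w(1,3) by (simp add: pos_le_divide_eq)
  then show ?thesis
    using w by (simp add: r_def w_def algebra_simps)
qed

lemma dual_norm_inner_le:
  assumes "spd (hessian f x)"
  shows "u \<bullet> h \<le> dual_norm f x u * local_norm f x h"
  using spd_Cauchy_Schwarz[OF assms, of u h] by (simp add: dual_norm_def local_norm_def)

text \<open>The dual norm of \<open>u\<close> at \<open>x\<close> is the supremum of \<open>u \<bullet> h\<close> over the steps \<open>h\<close> of local norm below 1.
  Such a step joins two points of \<open>X\<close>, and both lie in the outer ellipsoid around the analytic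
  center.\<close>

lemma dual_norm_le_center:
  fixes f :: "real^'n \<Rightarrow> real"
  assumes B: "self_concordant_barrier \<nu> X f" and X: "bounded X"
    and xc: "xc \<in> interior X" and x: "x \<in> interior X" and center: "gradient f xc = 0"
  shows "dual_norm f x u \<le> 2 * (\<nu> + 2 * sqrt \<nu>) * dual_norm f xc u"
proof -
  have \<nu>: "0 < \<nu>"
    by (rule barrier_parameter_pos[OF B X x])
  note spd = barrier_hessian_spd[OF B X]
  define v where "v = matrix_inv (hessian f x) *v u"
  define D where "D = dual_norm f x u"
  define R where "R = \<nu> + 2 * sqrt \<nu>"
  have D: "0 \<le> D" "D\<^sup>2 = u \<bullet> v"
    using spd_nonneg[OF spd_matrix_inv[OF spd[OF x]], of u] by (auto simp: D_def dual_norm_def v_def)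
  have norm_v: "local_norm f x v = D"
    using spd_invertible[OF spd[OF x]]
    by (simp add: local_norm_def v_def D_def dual_norm_def inner_commute)
  have dc: "0 \<le> dual_norm f xc u"
    using spd_nonneg[OF spd_matrix_inv[OF spd[OF xc]], of u] by (simp add: dual_norm_def)
  have R: "u \<bullet> (z - xc) \<le> dual_norm f xc u * R" "- (u \<bullet> (z - xc)) \<le> dual_norm f xc u * R"
    if z: "z \<in> interior X" for z
  proof -
    have "\<bar>u \<bullet> (z - xc)\<bar> \<le> dual_norm f xc u * local_norm f xc (z - xc)"
      using spd_Cauchy_Schwarz[OF spd[OF xc]] by (simp add: dual_norm_def local_norm_def)
    also have "\<dots> \<le> dual_norm f xc u * R"
      unfolding R_def by (intro mult_left_mono barrier_outer_ellipsoid[OF B \<nu> xc z center] dc)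
    finally show "u \<bullet> (z - xc) \<le> dual_norm f xc u * R" "- (u \<bullet> (z - xc)) \<le> dual_norm f xc u * R"
      by auto
  qed
  have "\<theta> * D \<le> 2 * R * dual_norm f xc u" if \<theta>: "0 < \<theta>" "\<theta> < 1" for \<theta>
  proof (cases "D = 0")
    case True
    then show ?thesis
      using dc \<nu> by (simp add: R_def)
  next
    case False
    \<comment> \<open>The direction in which \<open>u\<close> is largest, scaled into the open ellipsoid.\<close>
    define h where "h = (\<theta> / D) *\<^sub>R v"
    have "local_norm f x h = \<theta>"
      using False D \<theta> by (simp add: h_def local_norm_scaleR norm_v)
    then have "x + h \<in> interior X"
      using Dikin_ellipsoid[OF B x] \<theta> by simp
    moreover have "u \<bullet> h = \<theta> * D"
      using False by (simp add: h_def D(2)[symmetric] power2_eq_square)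
    moreover have "u \<bullet> h = u \<bullet> (x + h - xc) - u \<bullet> (x - xc)"
      by (simp add: inner_add_right inner_diff_right)
    ultimately show ?thesis
      using R(1)[of "x + h"] R(2)[OF x] by (simp only:) argo
  qed
  then show ?thesis
    unfolding D_def R_def by (rule field_le_mult_one_interval)
qed

section \<open>The functions omega and the step size\<close>

text \<open>Young's inequality of the conjugate pair \<open>omega\<close>, \<open>omega_star\<close>. With
  \<open>q = (1 + \<tau>) (1 - \<kappa>)\<close> it is \<open>ln q \<le> q - 1\<close>; equality holds at \<open>\<tau> = \<kappa> / (1 - \<kappa>)\<close>.\<close>

lemma omega_Fenchel:
  assumes "\<kappa> < 1" "0 \<le> \<tau>"
  shows "\<kappa> * \<tau> - omega \<tau> \<le> omega_star \<kappa>"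
proof -
  have "ln ((1 + \<tau>) * (1 - \<kappa>)) \<le> (1 + \<tau>) * (1 - \<kappa>) - 1"
    using assms by (intro ln_le_minus_one mult_pos_pos) auto
  moreover have "ln ((1 + \<tau>) * (1 - \<kappa>)) = ln (1 + \<tau>) + ln (1 - \<kappa>)"
    using assms by (intro ln_mult_pos) auto
  ultimately show ?thesis
    by (simp add: omega_def omega_star_def algebra_simps)
qed

lemma omega_Fenchel_eq:
  assumes "\<kappa> < 1"
  shows "\<kappa> * (\<kappa> / (1 - \<kappa>)) - omega_star \<kappa> = omega (\<kappa> / (1 - \<kappa>))"
proof -
  have "1 + \<kappa> / (1 - \<kappa>) = inverse (1 - \<kappa>)"
    using assms by (simp add: field_simps)
  then have "ln (1 + \<kappa> / (1 - \<kappa>)) = - ln (1 - \<kappa>)"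
    using assms by (simp add: ln_inverse)
  then show ?thesis
    using assms by (simp add: omega_def omega_star_def field_simps)
qed

lemma omega_mono:
  assumes "0 \<le> s" "s \<le> r"
  shows "omega s \<le> omega r"
proof -
  have "ln (1 + r) - ln (1 + s) \<le> (1 + r - (1 + s)) / (1 + s)"
    using assms by (intro ln_diff_le) auto
  also have "\<dots> \<le> (r - s) / 1"
    using assms by (intro frac_le) auto
  finally show ?thesis
    by (simp add: omega_def)
qed

lemma omega_pos:
  assumes "0 < s"
  shows "0 < omega s"
  using assms ln_le_minus_one[of "1 + s"] ln_eq_minus_one[of "1 + s"] by (force simp: omega_def)

text \<open>Closed form of \<open>u = \<alpha> l + \<delta>\<close>, the local length \<open>\<alpha> l\<close> of a step with step size \<open>\<alpha>\<close> plus the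
  gradient error \<open>\<delta>\<close>. It is the larger root of \<open>u\<^sup>2 = l (u - \<delta>) (1 - u)\<close>, that is, of
  \<open>\<alpha> l\<^sup>2 = u\<^sup>2 / (1 - u)\<close>, and this equation is what makes the guaranteed decrease
  \<open>\<alpha> l\<^sup>2 - omega_star u\<close> a value of \<open>omega\<close>.\<close>

definition displacement :: "real \<Rightarrow> real \<Rightarrow> real" where
  "displacement \<delta> l = ((1 + \<delta>) * l + sqrt ((1 - \<delta>)\<^sup>2 * l\<^sup>2 - 4 * \<delta> * l)) / (2 * (1 + l))"

lemma step_equation:
  assumes \<delta>: "0 < \<delta>" "\<delta> < 1" and l: "0 < l" and disc: "4 * \<delta> \<le> (1 - \<delta>)\<^sup>2 * l"
  defines "u \<equiv> displacement \<delta> l"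
  shows "step_size \<delta> l * l + \<delta> = u" and "0 < step_size \<delta> l" and "0 < u" and "u < 1"
    and "u\<^sup>2 = l * (u - \<delta>) * (1 - u)" and "eta_lower \<delta> l = u / (1 - u)"
proof -
  define S where "S = sqrt ((1 - \<delta>)\<^sup>2 * l\<^sup>2 - 4 * \<delta> * l)"
  have "4 * \<delta> * l \<le> (1 - \<delta>)\<^sup>2 * l * l"
    using disc l by (simp add: mult_right_mono)
  then have D: "0 \<le> (1 - \<delta>)\<^sup>2 * l\<^sup>2 - 4 * \<delta> * l"
    by (simp add: power2_eq_square)
  then have S: "0 \<le> S" "S\<^sup>2 = (1 - \<delta>)\<^sup>2 * l\<^sup>2 - 4 * \<delta> * l"
    by (auto simp: S_def)
  have "S \<le> sqrt (((1 - \<delta>) * l)\<^sup>2)"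
    unfolding S_def using \<delta> l by (intro real_sqrt_le_mono) (simp add: power_mult_distrib)
  then have S_le: "S \<le> (1 - \<delta>) * l"
    using \<delta> l by simp
  have "2 * \<delta> * (1 - \<delta>) < 4 * \<delta>"
    using \<delta> by (simp add: algebra_simps add_strict_increasing2)
  also have "\<dots> \<le> (1 - \<delta>) * l * (1 - \<delta>)"
    using disc by (simp add: power2_eq_square algebra_simps)
  finally have big: "2 * \<delta> < (1 - \<delta>) * l"
    using \<delta> by (simp add: mult.commute)
  have u: "u = ((1 + \<delta>) * l + S) / (2 * (1 + l))"
    by (simp add: u_def displacement_def S_def)
  have step: "step_size \<delta> l = ((1 - \<delta>) * l - 2 * \<delta> + S) / (2 * l * (1 + l))"
    by (simp add: step_size_def S_def)
  show "0 < step_size \<delta> l"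
    unfolding step using big S l by (intro divide_pos_pos) auto
  have "step_size \<delta> l * l = ((1 - \<delta>) * l - 2 * \<delta> + S) / (2 * (1 + l))"
    unfolding step using l by simp
  then show "step_size \<delta> l * l + \<delta> = u"
    unfolding u using l by (simp add: field_simps)
  show "0 < u"
    unfolding u using \<delta> l S by (intro divide_pos_pos add_pos_nonneg) auto
  have minus_\<delta>: "u - \<delta> = ((1 - \<delta>) * l - 2 * \<delta> + S) / (2 * (1 + l))"
    unfolding u using l by (simp add: field_simps)
  have one_minus: "1 - u = (2 + (1 - \<delta>) * l - S) / (2 * (1 + l))"
    unfolding u using l by (simp add: field_simps)
  then have "0 < 1 - u"
    using S_le l by simp
  then show "u < 1"
    by simp
  have num: "((1 + \<delta>) * l + S)\<^sup>2 = l * ((1 - \<delta>) * l - 2 * \<delta> + S) * (2 + (1 - \<delta>) * l - S)"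
    using S(2) by algebra
  have "u\<^sup>2 = ((1 + \<delta>) * l + S)\<^sup>2 / (2 * (1 + l))\<^sup>2"
    unfolding u by (simp add: power_divide)
  also have "\<dots> = l * (u - \<delta>) * (1 - u)"
    unfolding num minus_\<delta> one_minus by (simp add: power2_eq_square)
  finally show eq: "u\<^sup>2 = l * (u - \<delta>) * (1 - u)" .
  have "eta_lower \<delta> l = l * (u - \<delta>) / u"
    unfolding eta_lower_def S_def[symmetric] minus_\<delta> by (subst u) (use l in simp)
  also have "\<dots> = u / (1 - u)"
    using \<open>0 < u\<close> \<open>0 < 1 - u\<close> eq by (simp add: field_simps power2_eq_square)
  finally show "eta_lower \<delta> l = u / (1 - u)" .
qed

lemma eta_lower_mono:
  assumes \<delta>: "0 < \<delta>" "\<delta> < 1" and \<beta>: "0 < \<beta>" and disc: "4 * \<delta> \<le> (1 - \<delta>)\<^sup>2 * \<beta>" and l: "\<beta> \<le> l"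
  shows "0 < eta_lower \<delta> \<beta>" and "eta_lower \<delta> \<beta> \<le> eta_lower \<delta> l"
proof -
  define v where "v = displacement \<delta> \<beta>"
  define u where "u = displacement \<delta> l"
  have disc_l: "4 * \<delta> \<le> (1 - \<delta>)\<^sup>2 * l"
    using disc l by (meson mult_left_mono order_trans zero_le_power2)
  note V = step_equation[OF \<delta> \<beta> disc, folded v_def]
  note U = step_equation[OF \<delta> less_le_trans[OF \<beta> l] disc_l, folded u_def]
  show "0 < eta_lower \<delta> \<beta>"
    using V(3,4,6) by simp
  have "0 < v - \<delta>"
    using V(1,2) \<beta> by (metis add_diff_cancel_right' mult_pos_pos)
  then have "0 \<le> (v - \<delta>) * (1 - v)"
    using V(4) by simp
  then have "v\<^sup>2 \<le> l * (v - \<delta>) * (1 - v)"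
    using V(5) l by (simp add: mult_right_mono mult.assoc)
  \<comment> \<open>So the quadratic of which \<open>u\<close> is the larger root is nonpositive at \<open>v\<close>.\<close>
  then have "4 * (1 + l) * (v\<^sup>2 - l * (v - \<delta>) * (1 - v)) \<le> 0"
    using \<beta> l by (intro mult_nonneg_nonpos) auto
  then have "(2 * (1 + l) * v - (1 + \<delta>) * l)\<^sup>2 \<le> (1 - \<delta>)\<^sup>2 * l\<^sup>2 - 4 * \<delta> * l"
    by (simp add: algebra_simps power2_eq_square)
  then have "2 * (1 + l) * v - (1 + \<delta>) * l \<le> sqrt ((1 - \<delta>)\<^sup>2 * l\<^sup>2 - 4 * \<delta> * l)"
    by (rule real_le_rsqrt)
  then have "v \<le> u"
    using \<beta> l by (simp add: u_def displacement_def pos_le_divide_eq algebra_simps)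
  then show "eta_lower \<delta> \<beta> \<le> eta_lower \<delta> l"
    unfolding V(6) U(6) using V(3) U(4) by (intro frac_le) auto
qed

text \<open>In terms of \<open>w = sqrt (1 + \<beta>)\<close> the bound is \<open>(w - 1) / (w + 1)\<close>, and the discriminant is
  nonnegative for all smaller \<open>\<delta>\<close>.\<close>

lemma delta_hat_discriminant:
  assumes \<beta>: "0 < \<beta>" and \<delta>: "0 < \<delta>" "\<delta> < delta_hat_star \<beta>"
  shows "\<delta> < 1" and "4 * \<delta> \<le> (1 - \<delta>)\<^sup>2 * \<beta>"
proof -
  define w where "w = sqrt (1 + \<beta>)"
  have "w\<^sup>2 = 1 + \<beta>" "1 < w"
    using \<beta> by (simp_all add: w_def)
  then have w: "1 < w" "\<beta> = (w - 1) * (w + 1)"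
    by (simp_all add: algebra_simps power2_eq_square)
  have "2 + \<beta> + 2 * sqrt (1 + \<beta>) = (w + 1) * (w + 1)"
    unfolding w_def[symmetric] by (simp add: w(2) algebra_simps)
  then have star: "delta_hat_star \<beta> = (w - 1) / (w + 1)"
    unfolding delta_hat_star_def using w by simp
  have less: "\<delta> * (w + 1) < w - 1"
    using \<delta>(2) w(1) unfolding star by (simp add: pos_less_divide_eq)
  then have "\<delta> * (w + 1) < 1 * (w + 1)"
    by simp
  then show "\<delta> < 1"
    by (rule mult_right_less_imp_less) (use w(1) in simp)
  from less have gap: "2 \<le> (1 - \<delta>) * (w + 1)"
    by (simp add: algebra_simps)
  have "2 * 2 \<le> ((1 - \<delta>) * (w + 1)) * ((1 - \<delta>) * (w + 1))"
    using gap by (intro mult_mono) auto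
  then have "4 * \<delta> \<le> ((1 - \<delta>) * (w + 1)) * ((1 - \<delta>) * (w + 1)) * \<delta>"
    using \<delta> by (simp add: mult_right_mono)
  also have "\<dots> = (1 - \<delta>)\<^sup>2 * (w + 1) * (\<delta> * (w + 1))"
    by (simp add: power2_eq_square algebra_simps)
  also have "\<dots> \<le> (1 - \<delta>)\<^sup>2 * (w + 1) * (w - 1)"
    using less w by (intro mult_left_mono) auto
  finally show "4 * \<delta> \<le> (1 - \<delta>)\<^sup>2 * \<beta>"
    by (simp add: w(2) mult_ac)
qed

section \<open>Positivity of the neighbourhood parameter\<close>

lemma discriminant_crit_poly:
  "cubic_discriminant (crit_poly \<delta>) =
    (let p = \<delta> * (1 / (1 - \<delta>)\<^sup>2 + 2 / (1 - \<delta>)); c0 = - 2 * \<delta> * (1 - \<delta>)\<^sup>2;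
       c1 = (1 - \<delta>) * ((1 + \<delta>)\<^sup>2 - p); c2 = p - 3 - 2 * \<delta>\<^sup>2 + 2 * \<delta>; c3 = 1 - \<delta>
     in c1\<^sup>2 * c2\<^sup>2 - 4 * c3 * c1 ^ 3 - 4 * c2 ^ 3 * c0 - 27 * c3\<^sup>2 * c0\<^sup>2 + 18 * c3 * c2 * c1 * c0)"
  by (simp add: cubic_discriminant_def crit_poly_def Let_def coeff_pCons numeral_2_eq_2 numeral_3_eq_3)

text \<open>The discriminant is 5 at 0 and negative at \<open>1/10\<close>, a point with simple decimals beyond its
  first zero.\<close>

lemma delta_bar_max_le: "delta_bar_max \<le> 1 / 10"
proof -
  let ?d = "\<lambda>\<delta>. cubic_discriminant (crit_poly \<delta>)"
  have "continuous_on {0..1/10} ?d"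
    unfolding discriminant_crit_poly Let_def by (intro continuous_intros) auto
  moreover have "?d 0 \<ge> 0" "?d (1/10) \<le> 0"
    unfolding discriminant_crit_poly Let_def by (simp_all add: power2_eq_square power3_eq_cube)
  ultimately obtain x where x: "0 \<le> x" "x \<le> 1/10" "?d x = 0"
    using IVT2'[of ?d "1/10" 0 0] by auto
  moreover have "?d 0 \<noteq> 0"
    unfolding discriminant_crit_poly Let_def by simp
  ultimately have "x \<in> {\<delta>. 0 < \<delta> \<and> ?d \<delta> = 0}"
    by (cases "x = 0") auto
  then have "delta_bar_max \<le> x"
    unfolding delta_bar_max_def by (rule cInf_lower) (auto intro!: bdd_belowI[of _ 0])
  with x show ?thesis
    by simp
qed

text \<open>For \<open>\<delta> \<le> 1/10\<close> the coefficients alternate in sign, so no root is negative. A root exists, so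
  the list of roots is nonempty and its first entry is a root.\<close>

lemma beta_lower_nonneg:
  assumes \<delta>: "0 \<le> \<delta>" "\<delta> \<le> 1 / 10"
  shows "0 \<le> beta_lower \<delta>"
proof -
  define p where "p = \<delta> * (1 / (1 - \<delta>)\<^sup>2 + 2 / (1 - \<delta>))"
  have p: "0 \<le> p" "p \<le> 1 / 2"
  proof -
    show "0 \<le> p"
      using \<delta> by (simp add: p_def)
    have "(9/10 :: real)\<^sup>2 \<le> (1 - \<delta>)\<^sup>2"
      using \<delta> by (intro power_mono) auto
    then have "1 / (1 - \<delta>)\<^sup>2 \<le> 1 / (9/10)\<^sup>2"
      by (intro divide_left_mono) (use \<delta> in auto)
    moreover have "2 / (1 - \<delta>) \<le> 2 / (9/10)"
      using \<delta> by (intro divide_left_mono) auto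
    ultimately have "1 / (1 - \<delta>)\<^sup>2 + 2 / (1 - \<delta>) \<le> 5"
      by (simp add: power2_eq_square)
    then have "p \<le> 1/10 * 5"
      unfolding p_def using \<delta> by (intro mult_mono) auto
    then show "p \<le> 1 / 2"
      by simp
  qed
  define c0 where "c0 = 2 * \<delta> * (1 - \<delta>)\<^sup>2"
  define c1 where "c1 = (1 - \<delta>) * ((1 + \<delta>)\<^sup>2 - p)"
  define c2 where "c2 = 3 + 2 * \<delta>\<^sup>2 - 2 * \<delta> - p"
  define c3 where "c3 = 1 - \<delta>"
  have poly: "poly (crit_poly \<delta>) x = - c0 + x * c1 - x\<^sup>2 * c2 + x ^ 3 * c3" for x
    unfolding crit_poly_def Let_def p_def[symmetric]
    by (simp add: c0_def c1_def c2_def c3_def algebra_simps power2_eq_square power3_eq_cube)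
  have sq: "\<delta>\<^sup>2 \<le> 1/10 * (1/10)"
    unfolding power2_eq_square using \<delta> by (intro mult_mono) auto
  have c: "0 \<le> c0" "c0 \<le> 1/5" "0 \<le> c1" "0 \<le> c2" "c2 \<le> 31/10" "9/10 \<le> c3"
  proof -
    show "0 \<le> c0"
      using \<delta> by (simp add: c0_def)
    have "(1 - \<delta>)\<^sup>2 \<le> 1"
      using \<delta> by (simp add: power_le_one)
    then have "2 * \<delta> * (1 - \<delta>)\<^sup>2 \<le> 2 * (1/10) * 1"
      using \<delta> by (intro mult_mono) auto
    then show "c0 \<le> 1/5"
      by (simp add: c0_def)
    have "1 \<le> (1 + \<delta>)\<^sup>2"
      using \<delta> by simp
    then have "0 \<le> (1 + \<delta>)\<^sup>2 - p"
      using p by simp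
    then show "0 \<le> c1"
      unfolding c1_def using \<delta> by (intro mult_nonneg_nonneg) auto
    show "0 \<le> c2" "c2 \<le> 31/10" "9/10 \<le> c3"
      using \<delta> p sq zero_le_power2[of \<delta>] unfolding c2_def c3_def by linarith+
  qed
  let ?R = "{x. poly (crit_poly \<delta>) x = 0}"
  \<comment> \<open>At 4 the cubic term dominates: \<open>64 * 9/10 > 16 * 31/10 + 1/5\<close>.\<close>
  have "poly (crit_poly \<delta>) 4 > 0"
    using c unfolding poly by simp
  moreover have "poly (crit_poly \<delta>) 0 \<le> 0"
    using c unfolding poly by simp
  ultimately have ne: "?R \<noteq> {}"
    using IVT'[of "poly (crit_poly \<delta>)" 0 0 4, OF _ _ _ continuous_on_poly[OF continuous_on_id]] by auto
  have "crit_poly \<delta> \<noteq> 0"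
    using \<open>poly (crit_poly \<delta>) 4 > 0\<close> by auto
  then have fin: "finite ?R"
    by (rule poly_roots_finite)
  have "0 < length (sorted_list_of_set ?R)"
    using ne fin by (simp add: card_gt_0_iff)
  then have "beta_lower \<delta> \<in> set (sorted_list_of_set ?R)"
    unfolding beta_lower_def by (rule nth_mem)
  then have "beta_lower \<delta> \<in> ?R"
    by (simp only: set_sorted_list_of_set[OF fin])
  then have root: "poly (crit_poly \<delta>) (beta_lower \<delta>) = 0"
    by simp
  show ?thesis
  proof (rule ccontr)
    assume "\<not> 0 \<le> beta_lower \<delta>"
    then have neg: "beta_lower \<delta> < 0"
      by simp
    then have "beta_lower \<delta> ^ 3 * c3 < 0"
      using c by (intro mult_neg_pos) (auto simp: power3_eq_cube mult_neg_pos mult_pos_neg mult_neg_neg)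
    moreover have "beta_lower \<delta> * c1 \<le> 0" "0 \<le> (beta_lower \<delta>)\<^sup>2 * c2"
      using neg c by (auto simp: mult_nonpos_nonneg)
    ultimately show False
      using root c(1) unfolding poly by linarith
  qed
qed

section \<open>Descent of the smoothed dual function\<close>

lemma lagrangian_smoothed_diff:
  "lagrangian_smoothed F xc A b c t y x = lagrangian_smoothed F xc A b c t y z
     + (c + transpose A *v y) \<bullet> (x - z) - t * (F x - F z)"
proof -
  have "y \<bullet> (A *v (x - z)) = (transpose A *v y) \<bullet> (x - z)"
    by (metis dot_lmul_matrix transpose_matrix_vector)
  then have "(transpose A *v y) \<bullet> (x - z) = y \<bullet> (A *v x) - y \<bullet> (A *v z)"
    by (simp add: matrix_vector_mult_diff_distrib inner_diff_right)
  then show ?thesis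
    unfolding inner_add_left by (simp add: lagrangian_smoothed_def inner_diff_right algebra_simps)
qed

text \<open>An approximate maximizer certifies its own quality: since \<open>F\<close> grows at least like
  \<open>omega\<close> of the local distance, a gradient of local dual norm \<open>t \<kappa>\<close> permits a gain of at most
  \<open>t\<close> times the conjugate function \<open>omega_star\<close> at \<open>\<kappa>\<close>.\<close>

lemma lagrangian_smoothed_le:
  fixes F :: "real^'n \<Rightarrow> real"
  assumes sc: "self_concordant_on S F" "open S" and z: "z \<in> S" and x: "x \<in> S" and t: "0 < t"
    and grad: "\<And>h. (c + transpose A *v y - t *\<^sub>R gradient F z) \<bullet> h \<le> t * (\<kappa> * local_norm F z h)"
    and \<kappa>: "\<kappa> < 1"
  shows "lagrangian_smoothed F xc A b c t y x \<le> lagrangian_smoothed F xc A b c t y z + t * omega_star \<kappa>"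
proof -
  let ?h = "x - z"
  let ?\<tau> = "local_norm F z ?h"
  have \<tau>: "0 \<le> ?\<tau>"
    using self_concordant_hessian_nonneg[OF sc z] by (simp add: local_norm_def)
  have "t * (gradient F z \<bullet> ?h + omega ?\<tau>) \<le> t * (F x - F z)"
    using self_concordant_lower_bounds(2)[OF sc z x] t by (intro mult_left_mono) auto
  then have "(c + transpose A *v y) \<bullet> ?h - t * (F x - F z)
      \<le> (c + transpose A *v y - t *\<^sub>R gradient F z) \<bullet> ?h - t * omega ?\<tau>"
    by (simp add: inner_diff_left algebra_simps)
  also have "\<dots> \<le> t * (\<kappa> * ?\<tau> - omega ?\<tau>)"
    using grad[of ?h] by (simp add: right_diff_distrib)
  also have "\<dots> \<le> t * omega_star \<kappa>"
    using t omega_Fenchel[OF \<kappa> \<tau>] by (intro mult_left_mono) auto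
  finally show ?thesis
    using lagrangian_smoothed_diff[of F xc A b c t y x z] by linarith
qed

text \<open>The dual Hessian is \<open>A\<close> times the inverse primal Hessian times the transpose of \<open>A\<close>, divided by
  \<open>t\<close>. Hence the dual norm of the transpose of \<open>A\<close> applied to the Newton direction is, up to the
  factor \<open>t\<close>, the Newton decrement: the decrement is the length of the step in primal units.\<close>

lemma newton_direction_facts:
  fixes F :: "real^'n \<Rightarrow> real" and A :: "real^'n^'m" and b :: "real^'m"
  assumes H: "spd (hessian F x)" and A: "rank A = CARD('m)" and t: "0 < t"
  defines "l \<equiv> newton_decrement F A b t x" and "d \<equiv> newton_direction F A b t x"
  shows "d \<bullet> residual A b x = t * l\<^sup>2" and "dual_norm F x (transpose A *v d) = t * l"
    and "0 \<le> l"
proof -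
  let ?D = "dual_hessian F A t x"
  let ?M = "matrix_inv (hessian F x)"
  have D: "spd ?D"
    unfolding dual_hessian_def
    using spd_scaleR[OF spd_congruence[OF spd_matrix_inv[OF H] A], of "1 / t"] t by simp
  have Dd: "?D *v d = residual A b x"
    by (simp add: d_def newton_direction_def spd_invertible[OF D])
  have "0 \<le> d \<bullet> residual A b x"
    using spd_nonneg[OF D, of d] Dd by simp
  then have nonneg: "0 \<le> 1 / t * (d \<bullet> residual A b x)"
    using t by simp
  have lam: "l = sqrt (1 / t * (d \<bullet> residual A b x))"
    by (simp add: l_def d_def newton_decrement_def inner_commute)
  show "0 \<le> l"
    using nonneg by (simp add: lam)
  show sq: "d \<bullet> residual A b x = t * l\<^sup>2"
    unfolding lam real_sqrt_pow2[OF nonneg] using t by simp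
  have "(transpose A *v d) \<bullet> (?M *v (transpose A *v d)) = d \<bullet> ((A ** ?M ** transpose A) *v d)"
    by (metis dot_lmul_matrix transpose_matrix_vector matrix_vector_mul_assoc)
  also have "\<dots> = t * (d \<bullet> (?D *v d))"
    using t by (simp add: dual_hessian_def scaleR_matrix_vector_assoc[symmetric])
  also have "\<dots> = (t * l)\<^sup>2"
    using sq Dd by (simp add: power2_eq_square)
  finally show "dual_norm F x (transpose A *v d) = t * l"
    unfolding dual_norm_def using t \<open>0 \<le> l\<close> by simp
qed

text \<open>One damped Newton step. At the new multiplier the gradient of the Lagrangian at the old
  point \<open>x\<close> consists of the old error, of size at most \<open>\<delta>\<close>, and of the step, of size \<open>\<alpha> l\<close>; both
  together make the displacement \<open>u\<close>. The Lagrangian at \<open>x\<close> itself falls by \<open>t \<alpha> l\<^sup>2\<close>, the new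
  maximum exceeds it by at most \<open>t omega_star u\<close>, and the balance is \<open>t omega (u / (1 - u))\<close>.\<close>

lemma damped_newton_step_descent:
  fixes F :: "real^'n \<Rightarrow> real" and A :: "real^'n^'m" and b :: "real^'m"
  assumes sc: "self_concordant_on S F" "open S" and x: "x \<in> S" and z: "z \<in> S"
    and H: "spd (hessian F x)" and A: "rank A = CARD('m)" and t: "0 < t"
    and acc: "dual_norm F x (c + transpose A *v y - t *\<^sub>R gradient F x) \<le> t * \<delta>"
  defines "l \<equiv> newton_decrement F A b t x"
  assumes \<delta>: "0 < \<delta>" "\<delta> < 1" and l: "0 < l" and disc: "4 * \<delta> \<le> (1 - \<delta>)\<^sup>2 * l"
    and y': "y' = y - step_size \<delta> l *\<^sub>R newton_direction F A b t x"
  shows "lagrangian_smoothed F xc A b c t y' z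
    \<le> lagrangian_smoothed F xc A b c t y x - t * omega (eta_lower \<delta> l)"
proof -
  define \<alpha> where "\<alpha> = step_size \<delta> l"
  define d where "d = newton_direction F A b t x"
  define u where "u = displacement \<delta> l"
  note N = newton_direction_facts[OF H A t, of b, folded l_def d_def]
  note U = step_equation[OF \<delta> l disc, folded \<alpha>_def u_def]
  have y'_eq: "y' = y - \<alpha> *\<^sub>R d"
    by (simp add: y' \<alpha>_def d_def)
  let ?r = "c + transpose A *v y - t *\<^sub>R gradient F x"
  have "(c + transpose A *v y' - t *\<^sub>R gradient F x) \<bullet> h \<le> t * (u * local_norm F x h)" for h
  proof -
    have n: "0 \<le> local_norm F x h"
      using spd_nonneg[OF H] by (simp add: local_norm_def)
    have "c + transpose A *v y' - t *\<^sub>R gradient F x = ?r - \<alpha> *\<^sub>R (transpose A *v d)"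
      unfolding y'_eq matrix_vector_mult_diff_distrib matrix_vector_mult_scaleR by simp
    then have "(c + transpose A *v y' - t *\<^sub>R gradient F x) \<bullet> h
        = ?r \<bullet> h + \<alpha> * ((transpose A *v d) \<bullet> (- h))"
      by (simp only: inner_diff_left inner_scaleR_left inner_minus_right)
    also have "?r \<bullet> h \<le> (t * \<delta>) * local_norm F x h"
      using dual_norm_inner_le[OF H, of ?r h] mult_right_mono[OF acc n] by linarith
    also have "(transpose A *v d) \<bullet> (- h) \<le> t * l * local_norm F x (- h)"
      using dual_norm_inner_le[OF H, of "transpose A *v d" "- h"] unfolding N(2) .
    also have "local_norm F x (- h) = local_norm F x h"
      using local_norm_scaleR[of F x "- 1" h] by simp
    finally have "(c + transpose A *v y' - t *\<^sub>R gradient F x) \<bullet> h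
        \<le> t * \<delta> * local_norm F x h + \<alpha> * (t * l * local_norm F x h)"
      using U(2) by simp
    then show ?thesis
      unfolding U(1)[symmetric] by (simp add: algebra_simps)
  qed
  then have "lagrangian_smoothed F xc A b c t y' z
      \<le> lagrangian_smoothed F xc A b c t y' x + t * omega_star u"
    by (rule lagrangian_smoothed_le[OF sc x z t _ U(4)])
  also have "lagrangian_smoothed F xc A b c t y' x
      = lagrangian_smoothed F xc A b c t y x - \<alpha> * (t * l\<^sup>2)"
    unfolding N(1)[symmetric]
    by (simp add: lagrangian_smoothed_def y'_eq residual_def inner_diff_left)
  also have "\<alpha> * (t * l\<^sup>2) = t * (u * (u / (1 - u)))"
  proof -
    have "u - \<delta> = \<alpha> * l"
      using U(1) by simp
    then have "u\<^sup>2 = (\<alpha> * l\<^sup>2) * (1 - u)"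
      using U(5) by (simp add: power2_eq_square mult_ac)
    then have eq: "\<alpha> * l\<^sup>2 = u\<^sup>2 / (1 - u)"
      using U(4) by simp
    have "\<alpha> * (t * l\<^sup>2) = t * (\<alpha> * l\<^sup>2)"
      by simp
    then show ?thesis
      unfolding eq by (simp add: power2_eq_square)
  qed
  finally show ?thesis
    unfolding U(6) omega_Fenchel_eq[OF U(4), symmetric] by (simp add: right_diff_distrib)
qed

section \<open>Barriers of product sets\<close>

definition block_join :: "real^'n1 \<Rightarrow> real^'n2 \<Rightarrow> real^('n1::finite + 'n2::finite)" where
  "block_join u v = (\<chi> i. case i of Inl a \<Rightarrow> u $ a | Inr b \<Rightarrow> v $ b)"

definition block_diag ::
  "real^'n1^'n1 \<Rightarrow> real^'n2^'n2 \<Rightarrow> real^('n1::finite + 'n2::finite)^('n1 + 'n2)" where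
  "block_diag M N = (\<chi> i. case i of Inl a \<Rightarrow> block_join (M $ a) 0 | Inr b \<Rightarrow> block_join 0 (N $ b))"

lemma block_join_simps [simp]:
  "block1 (block_join u v) = u" "block2 (block_join u v) = v"
  by (simp_all add: block1_def block2_def block_join_def)

lemma block_eqI: "block1 x = block1 y \<Longrightarrow> block2 x = block2 y \<Longrightarrow> x = y"
  unfolding vec_eq_iff block1_def block2_def by (metis sum.exhaust vec_lambda_beta)

lemma sum_UNIV_Plus:
  fixes g :: "'a::finite + 'b::finite \<Rightarrow> 'c::comm_monoid_add"
  shows "(\<Sum>i\<in>UNIV. g i) = (\<Sum>a\<in>UNIV. g (Inl a)) + (\<Sum>b\<in>UNIV. g (Inr b))"
  unfolding UNIV_Plus_UNIV[symmetric] by (simp add: sum.Plus del: UNIV_Plus_UNIV)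

lemma inner_block: "x \<bullet> y = block1 x \<bullet> block1 y + block2 x \<bullet> block2 y"
  by (simp add: inner_vec_def sum_UNIV_Plus block1_def block2_def)

lemma bounded_linear_block1: "bounded_linear block1"
  and bounded_linear_block2: "bounded_linear block2"
  by (intro linear_conv_bounded_linear[THEN iffD1] linearI; simp add: block1_def block2_def vec_eq_iff)+

lemmas block_linear_simps =
  linear_simps[OF bounded_linear_block1] linear_simps[OF bounded_linear_block2]

lemma bounded_linear_block_join: "bounded_linear (\<lambda>p. block_join (fst p) (snd p))"
  by (intro linear_conv_bounded_linear[THEN iffD1] linearI)
    (auto intro!: block_eqI simp: block_linear_simps)

lemma block_diag_mult: "block_diag M N *v h = block_join (M *v block1 h) (N *v block2 h)"
proof -
  have "(block_diag M N *v h) $ i = block_join (M *v block1 h) (N *v block2 h) $ i" for i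
    by (cases i) (simp_all add: matrix_vector_mult_def sum_UNIV_Plus block_diag_def block_join_def
        block1_def block2_def)
  then show ?thesis
    by (simp add: vec_eq_iff)
qed

lemma bounded_linear_block_diag: "bounded_linear (\<lambda>p. block_diag (fst p) (snd p))"
proof -
  have "block_diag (M + M') (N + N') = block_diag M N + block_diag M' N'"
    "block_diag (r *\<^sub>R M) (r *\<^sub>R N) = r *\<^sub>R block_diag M N"
    for M M' :: "real^'a^'a" and N N' :: "real^'b^'b" and r
    by (auto simp: block_diag_def block_join_def vec_eq_iff split: sum.splits)
  then show ?thesis
    by (intro linear_conv_bounded_linear[THEN iffD1] linearI) auto
qed

lemma block_diag_form:
  "h \<bullet> (block_diag M N *v h) = block1 h \<bullet> (M *v block1 h) + block2 h \<bullet> (N *v block2 h)"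
  by (simp add: block_diag_mult inner_block)

lemma has_derivative_block_compose:
  assumes "bounded_linear (\<lambda>p. J (fst p) (snd p))"
    and "(f1 has_derivative f1') (at (block1 x))" and "(f2 has_derivative f2') (at (block2 x))"
  shows "((\<lambda>x. J (f1 (block1 x)) (f2 (block2 x))) has_derivative
    (\<lambda>h. J (f1' (block1 h)) (f2' (block2 h)))) (at x)"
proof -
  have "((\<lambda>x. (f1 (block1 x), f2 (block2 x))) has_derivative
      (\<lambda>h. (f1' (block1 h), f2' (block2 h)))) (at x)"
    by (intro has_derivative_Pair
        has_derivative_compose[OF bounded_linear_imp_has_derivative[OF bounded_linear_block1] assms(2)]
        has_derivative_compose[OF bounded_linear_imp_has_derivative[OF bounded_linear_block2] assms(3)])
  from bounded_linear.has_derivative[OF assms(1) this] show ?thesis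
    by simp
qed

lemma interior_block_product:
  "interior (block_product X1 X2) = block_product (interior X1) (interior X2)"
proof
  show "block_product (interior X1) (interior X2) \<subseteq> interior (block_product X1 X2)"
  proof (rule interior_maximal)
    show "block_product (interior X1) (interior X2) \<subseteq> block_product X1 X2"
      using interior_subset[of X1] interior_subset[of X2] by (auto simp: block_product_def)
    have "open (block1 -` interior X1 \<inter> block2 -` interior X2)"
      by (intro open_Int open_vimage open_interior linear_continuous_on
          bounded_linear_block1 bounded_linear_block2)
    then show "open (block_product (interior X1) (interior X2))"
      by (simp add: block_product_def vimage_def Collect_conj_eq)
  qed
  show "interior (block_product X1 X2) \<subseteq> block_product (interior X1) (interior X2)"
  proof
    fix x assume "x \<in> interior (block_product X1 X2)"
    then obtain e where e: "e > 0" "ball x e \<subseteq> block_product X1 X2"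
      using mem_interior by blast
    have n: "(norm (block_join u v))\<^sup>2 = (norm u)\<^sup>2 + (norm v)\<^sup>2" for u :: "real^'a" and v :: "real^'b"
      unfolding power2_norm_eq_inner inner_block[of "block_join _ _"] block_join_simps ..
    have "ball (block1 x) e \<subseteq> X1"
    proof
      fix u assume u: "u \<in> ball (block1 x) e"
      have "x - block_join u (block2 x) = block_join (block1 x - u) 0"
        by (intro block_eqI) (simp_all add: block_linear_simps)
      then have "dist x (block_join u (block2 x)) = dist (block1 x) u"
        using n[of "block1 x - u" 0] by (simp add: dist_norm)
      then have "block_join u (block2 x) \<in> block_product X1 X2"
        using u e by (auto simp: subset_iff)
      then show "u \<in> X1"
        by (simp add: block_product_def)
    qed
    moreover have "ball (block2 x) e \<subseteq> X2"
    proof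
      fix v assume v: "v \<in> ball (block2 x) e"
      have "x - block_join (block1 x) v = block_join 0 (block2 x - v)"
        by (intro block_eqI) (simp_all add: block_linear_simps)
      then have "dist x (block_join (block1 x) v) = dist (block2 x) v"
        using n[of 0 "block2 x - v"] by (simp add: dist_norm)
      then have "block_join (block1 x) v \<in> block_product X1 X2"
        using v e by (auto simp: subset_iff)
      then show "v \<in> X2"
        by (simp add: block_product_def)
    qed
    ultimately show "x \<in> block_product (interior X1) (interior X2)"
      using e(1) by (auto simp: block_product_def mem_interior)
  qed
qed

lemma bounded_block_product:
  assumes "bounded X1" "bounded X2"
  shows "bounded (block_product X1 X2)"
proof -
  have "block_product X1 X2 \<subseteq> (\<lambda>p. block_join (fst p) (snd p)) ` (X1 \<times> X2)"
  proof
    fix x assume "x \<in> block_product X1 X2"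
    moreover have "x = block_join (block1 x) (block2 x)"
      by (intro block_eqI) simp_all
    ultimately show "x \<in> (\<lambda>p. block_join (fst p) (snd p)) ` (X1 \<times> X2)"
      by (auto simp: block_product_def intro!: image_eqI[of _ _ "(block1 x, block2 x)"])
  qed
  then show ?thesis
    using bounded_linear_image[OF bounded_Times[OF assms] bounded_linear_block_join] bounded_subset
    by blast
qed

lemma powr_three_halves_superadditive:
  fixes a b :: real
  assumes "0 \<le> a" "0 \<le> b"
  shows "a powr (3/2) + b powr (3/2) \<le> (a + b) powr (3/2)"
proof -
  have eq: "x powr (3/2) = x * sqrt x" if "0 \<le> x" for x :: real
    using that powr_add[of x 1 "1/2"] by (cases "x = 0") (simp_all add: powr_half_sqrt)
  have "a * sqrt a + b * sqrt b \<le> a * sqrt (a + b) + b * sqrt (a + b)"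
    using assms by (intro add_mono mult_left_mono) auto
  then show ?thesis
    using assms by (simp add: eq distrib_right)
qed

text \<open>A convex function lies above a tangent plane, and a plane is bounded on a bounded set.\<close>

lemma barrier_bounded_below:
  fixes f :: "real^'n \<Rightarrow> real"
  assumes B: "self_concordant_barrier \<nu> X f" and X: "bounded X"
  shows "\<exists>C. \<forall>x\<in>interior X. C \<le> f x"
proof (cases "interior X = {}")
  case False
  then obtain x0 where x0: "x0 \<in> interior X"
    by auto
  note sc = self_concordant_barrierD(1)[OF B] open_interior
  have f: "convex_on (interior X) f"
    using sc by (simp add: self_concordant_on_def)
  obtain b where b: "\<And>z. z \<in> X \<Longrightarrow> norm z \<le> b"
    using X bounded_iff by blast
  have "f x0 - norm (gradient f x0) * (2 * b) \<le> f x" if x: "x \<in> interior X" for x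
  proof -
    have "norm (x - x0) \<le> 2 * b"
      using norm_triangle_ineq4[of x x0] b[of x] b[of x0] x x0 interior_subset[of X] by fastforce
    then have "norm (gradient f x0) * norm (x - x0) \<le> norm (gradient f x0) * (2 * b)"
      by (intro mult_left_mono) auto
    then have "- (norm (gradient f x0) * (2 * b)) \<le> gradient f x0 \<bullet> (x - x0)"
      using Cauchy_Schwarz_ineq2[of "gradient f x0" "x - x0"] by linarith
    then show ?thesis
      using convex_above_tangent[OF f x0 self_concordant_onD(1)[OF sc x0] x] by linarith
  qed
  then show ?thesis
    by blast
qed auto

locale block_barriers =
  fixes \<nu>1 \<nu>2 :: real and X1 :: "(real^'n1) set" and X2 :: "(real^'n2) set"
    and F1 :: "real^'n1 \<Rightarrow> real" and F2 :: "real^'n2 \<Rightarrow> real"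
  assumes B1: "self_concordant_barrier \<nu>1 X1 F1" and B2: "self_concordant_barrier \<nu>2 X2 F2"
    and bounded: "bounded X1" "bounded X2"
begin

definition X :: "(real^('n1 + 'n2)) set" where "X = block_product X1 X2"

definition F :: "real^('n1 + 'n2) \<Rightarrow> real" where "F = block_sum F1 F2"

lemmas sc1 = self_concordant_barrierD(1)[OF B1] open_interior
lemmas sc2 = self_concordant_barrierD(1)[OF B2] open_interior

lemma interior_iff: "x \<in> interior X \<longleftrightarrow> block1 x \<in> interior X1 \<and> block2 x \<in> interior X2"
  unfolding X_def interior_block_product by (simp add: block_product_def)

lemma interiorD:
  assumes "x \<in> interior X"
  shows "block1 x \<in> interior X1" "block2 x \<in> interior X2"
  using assms interior_iff by blast+

lemma has_gradient:
  assumes "x \<in> interior X"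
  shows "(F has_derivative (\<lambda>h. block_join (gradient F1 (block1 x)) (gradient F2 (block2 x)) \<bullet> h)) (at x)"
proof -
  have "bounded_linear (\<lambda>p :: real \<times> real. fst p + snd p)"
    by (intro bounded_linear_add bounded_linear_fst bounded_linear_snd)
  from has_derivative_block_compose[of "(+)", OF this
      gradient_has_derivative[OF self_concordant_onD(1)[OF sc1 interiorD(1)[OF assms]]]
      gradient_has_derivative[OF self_concordant_onD(1)[OF sc2 interiorD(2)[OF assms]]]]
  have "((\<lambda>x. F1 (block1 x) + F2 (block2 x)) has_derivative
      (\<lambda>h. gradient F1 (block1 x) \<bullet> block1 h + gradient F2 (block2 x) \<bullet> block2 h)) (at x)" .
  moreover have "F = (\<lambda>x. F1 (block1 x) + F2 (block2 x))"
    by (simp add: fun_eq_iff F_def block_sum_def)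
  ultimately show ?thesis
    unfolding inner_block[of "block_join _ _"] block_join_simps by simp
qed

lemma gradient_eq:
  "x \<in> interior X \<Longrightarrow> gradient F x = block_join (gradient F1 (block1 x)) (gradient F2 (block2 x))"
  using gradient_eqI[OF has_gradient] .

lemma has_hessian:
  assumes x: "x \<in> interior X"
  shows "(gradient F has_derivative
    (\<lambda>h. block_diag (hessian F1 (block1 x)) (hessian F2 (block2 x)) *v h)) (at x)"
proof (rule has_derivative_transform_within_open[OF _ open_interior x])
  show "((\<lambda>x. block_join (gradient F1 (block1 x)) (gradient F2 (block2 x))) has_derivative
      (\<lambda>h. block_diag (hessian F1 (block1 x)) (hessian F2 (block2 x)) *v h)) (at x)"
    unfolding block_diag_mult
    by (intro has_derivative_block_compose bounded_linear_block_join hessian_has_derivative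
        self_concordant_onD(2)[OF sc1 interiorD(1)[OF x]] self_concordant_onD(2)[OF sc2 interiorD(2)[OF x]])
qed (simp add: gradient_eq)

lemma hessian_eq:
  "x \<in> interior X \<Longrightarrow> hessian F x = block_diag (hessian F1 (block1 x)) (hessian F2 (block2 x))"
  using hessian_eqI[OF has_hessian] .

lemma has_third_derivative:
  assumes x: "x \<in> interior X"
  shows "(hessian F has_derivative
    (\<lambda>h. block_diag (frechet_derivative (hessian F1) (at (block1 x)) (block1 h))
      (frechet_derivative (hessian F2) (at (block2 x)) (block2 h)))) (at x)"
proof (rule has_derivative_transform_within_open[OF _ open_interior x])
  show "((\<lambda>x. block_diag (hessian F1 (block1 x)) (hessian F2 (block2 x))) has_derivative
      (\<lambda>h. block_diag (frechet_derivative (hessian F1) (at (block1 x)) (block1 h))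
        (frechet_derivative (hessian F2) (at (block2 x)) (block2 h)))) (at x)"
    using self_concordant_onD(3)[OF sc1 interiorD(1)[OF x]] self_concordant_onD(3)[OF sc2 interiorD(2)[OF x]]
    by (intro has_derivative_block_compose bounded_linear_block_diag)
      (simp_all add: frechet_derivative_works[symmetric])
qed (simp add: hessian_eq)

lemma third_derivative_eq:
  "x \<in> interior X \<Longrightarrow> frechet_derivative (hessian F) (at x) h =
    block_diag (frechet_derivative (hessian F1) (at (block1 x)) (block1 h))
      (frechet_derivative (hessian F2) (at (block2 x)) (block2 h))"
  by (rule fun_cong[OF frechet_derivative_at[OF has_third_derivative], symmetric])

lemma hessian_form:
  "x \<in> interior X \<Longrightarrow> h \<bullet> (hessian F x *v h) =
    block1 h \<bullet> (hessian F1 (block1 x) *v block1 h) + block2 h \<bullet> (hessian F2 (block2 x) *v block2 h)"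
  by (simp add: hessian_eq block_diag_form)

lemma C3: "C3_on (interior X) F"
proof -
  have "continuous_on (interior X) (\<lambda>x. frechet_derivative (hessian F) (at x) h)" for h
  proof -
    have c1: "continuous_on (interior X1) (\<lambda>x. frechet_derivative (hessian F1) (at x) (block1 h))"
      and c2: "continuous_on (interior X2) (\<lambda>x. frechet_derivative (hessian F2) (at x) (block2 h))"
      using sc1(1) sc2(1) unfolding self_concordant_on_def C3_on_def by blast+
    have "continuous_on (interior X) block1" "continuous_on (interior X) block2"
      by (intro linear_continuous_on bounded_linear_block1 bounded_linear_block2)+
    then have "continuous_on (interior X) (\<lambda>x. (frechet_derivative (hessian F1) (at (block1 x)) (block1 h),
        frechet_derivative (hessian F2) (at (block2 x)) (block2 h)))"
      by (intro continuous_on_Pair continuous_on_compose2[OF c1] continuous_on_compose2[OF c2])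
        (auto dest: interiorD)
    from continuous_on_compose2[OF linear_continuous_on[OF bounded_linear_block_diag, of UNIV] this]
    have "continuous_on (interior X) (\<lambda>x. block_diag
        (frechet_derivative (hessian F1) (at (block1 x)) (block1 h))
        (frechet_derivative (hessian F2) (at (block2 x)) (block2 h)))"
      by simp
    then show ?thesis
      by (rule continuous_on_eq) (simp only: third_derivative_eq)
  qed
  moreover have "F differentiable (at x)" "gradient F differentiable (at x)" "hessian F differentiable (at x)"
    if "x \<in> interior X" for x
    using differentiableI[OF has_gradient[OF that]] differentiableI[OF has_hessian[OF that]]
      differentiableI[OF has_third_derivative[OF that]] by simp_all
  ultimately show ?thesis
    unfolding C3_on_def differentiable_on_def by (simp add: differentiable_at_withinI)
qed

lemma convex: "convex_on (interior X) F"
proof -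
  have c1: "convex_on (interior X1) F1" and c2: "convex_on (interior X2) F2"
    using sc1(1) sc2(1) unfolding self_concordant_on_def by blast+
  have "convex (interior X)"
  proof (rule convexI)
    fix x y and u v :: real
    assume xy: "x \<in> interior X" "y \<in> interior X" and uv: "0 \<le> u" "0 \<le> v" "u + v = 1"
    show "u *\<^sub>R x + v *\<^sub>R y \<in> interior X"
      unfolding interior_iff block_linear_simps
      using convexD[OF convex_on_imp_convex[OF c1] interiorD(1)[OF xy(1)] interiorD(1)[OF xy(2)] uv]
        convexD[OF convex_on_imp_convex[OF c2] interiorD(2)[OF xy(1)] interiorD(2)[OF xy(2)] uv] ..
  qed
  moreover have "F (u *\<^sub>R x + v *\<^sub>R y) \<le> u * F x + v * F y"
    if "x \<in> interior X" "y \<in> interior X" "0 \<le> u" "0 \<le> v" "u + v = 1" for x y u v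
  proof -
    have "F1 (u *\<^sub>R block1 x + v *\<^sub>R block1 y) \<le> u * F1 (block1 x) + v * F1 (block1 y)"
      "F2 (u *\<^sub>R block2 x + v *\<^sub>R block2 y) \<le> u * F2 (block2 x) + v * F2 (block2 y)"
      using c1 c2 that interiorD unfolding convex_on_def by blast+
    then show ?thesis
      by (simp add: F_def block_sum_def block_linear_simps algebra_simps)
  qed
  ultimately show ?thesis
    by (simp add: convex_on_def)
qed

lemma self_concordant: "self_concordant_on (interior X) F"
  unfolding self_concordant_on_def
proof (intro conjI ballI allI)
  fix x h :: "real^('n1 + 'n2)" assume x: "x \<in> interior X"
  note i = interiorD[OF x]
  let ?a = "block1 h \<bullet> (hessian F1 (block1 x) *v block1 h)"
  let ?b = "block2 h \<bullet> (hessian F2 (block2 x) *v block2 h)"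
  have "third_diff F x h = third_diff F1 (block1 x) (block1 h) + third_diff F2 (block2 x) (block2 h)"
    by (simp add: third_diff_def third_derivative_eq[OF x] block_diag_form)
  then have "\<bar>third_diff F x h\<bar> \<le> 2 * ?a powr (3/2) + 2 * ?b powr (3/2)"
    using self_concordant_onD(4)[OF sc1 i(1), of "block1 h"] self_concordant_onD(4)[OF sc2 i(2), of "block2 h"]
    by linarith
  also have "\<dots> \<le> 2 * (?a + ?b) powr (3/2)"
    using powr_three_halves_superadditive self_concordant_hessian_nonneg[OF sc1 i(1), of "block1 h"]
      self_concordant_hessian_nonneg[OF sc2 i(2), of "block2 h"] by fastforce
  finally show "\<bar>third_diff F x h\<bar> \<le> 2 * (h \<bullet> (hessian F x *v h)) powr (3/2)"
    by (simp add: hessian_form[OF x])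
qed (rule convex C3)+

text \<open>Each summand is bounded below on a bounded set, so it suffices that one of them blows up.\<close>

lemma blow_up:
  assumes z: "z \<in> frontier X"
  shows "filterlim F at_top (at z within interior X)"
proof -
  have ev: "\<forall>\<^sub>F x in at z within interior X. x \<in> interior X"
    by (simp add: eventually_at_filter)
  have cl: "block1 z \<in> closure X1" "block2 z \<in> closure X2"
  proof -
    have "z \<in> closure X"
      using z by (simp add: frontier_def)
    then have "block1 z \<in> closure (block1 ` X)" "block2 z \<in> closure (block2 ` X)"
      using closure_bounded_linear_image_subset[OF bounded_linear_block1]
        closure_bounded_linear_image_subset[OF bounded_linear_block2] by blast+
    moreover have "block1 ` X \<subseteq> X1" "block2 ` X \<subseteq> X2"
      by (auto simp: X_def block_product_def)
    ultimately show "block1 z \<in> closure X1" "block2 z \<in> closure X2"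
      using closure_mono by blast+
  qed
  have lim: "(block1 \<longlongrightarrow> block1 z) (at z within interior X)" "(block2 \<longlongrightarrow> block2 z) (at z within interior X)"
    by (intro bounded_linear.tendsto[OF bounded_linear_block1] bounded_linear.tendsto[OF bounded_linear_block2]
        tendsto_ident_at)+
  consider "block1 z \<in> frontier X1" | "block2 z \<in> frontier X2"
    using cl z by (auto simp: frontier_def interior_iff)
  then show ?thesis
  proof cases
    case 1
    have "filterlim block1 (at (block1 z) within interior X1) (at z within interior X)"
      unfolding filterlim_at
      using lim(1) 1 by (auto intro!: eventually_mono[OF ev] dest: interiorD simp: frontier_def)
    then have "filterlim (\<lambda>x. F1 (block1 x)) at_top (at z within interior X)"
      using filterlim_compose[OF self_concordant_barrierD(2)[OF B1 1]] by blast
    moreover obtain C where "\<And>x. x \<in> interior X2 \<Longrightarrow> C \<le> F2 x"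
      using barrier_bounded_below[OF B2 bounded(2)] by blast
    ultimately have "filterlim (\<lambda>x. C + F1 (block1 x)) at_top (at z within interior X)"
      and "\<forall>\<^sub>F x in at z within interior X. C + F1 (block1 x) \<le> F x"
      by (auto intro!: filterlim_tendsto_add_at_top[OF tendsto_const] eventually_mono[OF ev]
          dest: interiorD simp: F_def block_sum_def)
    then show ?thesis
      by (rule filterlim_at_top_mono)
  next
    case 2
    have "filterlim block2 (at (block2 z) within interior X2) (at z within interior X)"
      unfolding filterlim_at
      using lim(2) 2 by (auto intro!: eventually_mono[OF ev] dest: interiorD simp: frontier_def)
    then have "filterlim (\<lambda>x. F2 (block2 x)) at_top (at z within interior X)"
      using filterlim_compose[OF self_concordant_barrierD(2)[OF B2 2]] by blast
    moreover obtain C where "\<And>x. x \<in> interior X1 \<Longrightarrow> C \<le> F1 x"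
      using barrier_bounded_below[OF B1 bounded(1)] by blast
    ultimately have "filterlim (\<lambda>x. C + F2 (block2 x)) at_top (at z within interior X)"
      and "\<forall>\<^sub>F x in at z within interior X. C + F2 (block2 x) \<le> F x"
      by (auto intro!: filterlim_tendsto_add_at_top[OF tendsto_const] eventually_mono[OF ev]
          dest: interiorD simp: F_def block_sum_def)
    then show ?thesis
      by (rule filterlim_at_top_mono)
  qed
qed

text \<open>After expanding the square, the mixed term \<open>2 p q\<close> is the only one to be estimated. It is at
  most \<open>2 sqrt (\<nu>1 a \<nu>2 b)\<close>, hence at most \<open>\<nu>1 b + \<nu>2 a\<close> by the inequality of the arithmetic
  and the geometric mean.\<close>

lemma gradient_bound:
  assumes x: "x \<in> interior X"
  shows "(gradient F x \<bullet> h)\<^sup>2 \<le> (\<nu>1 + \<nu>2) * (h \<bullet> (hessian F x *v h))"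
proof -
  note i = interiorD[OF x]
  define a where "a = block1 h \<bullet> (hessian F1 (block1 x) *v block1 h)"
  define b where "b = block2 h \<bullet> (hessian F2 (block2 x) *v block2 h)"
  define p where "p = gradient F1 (block1 x) \<bullet> block1 h"
  define q where "q = gradient F2 (block2 x) \<bullet> block2 h"
  have ab: "0 \<le> a" "0 \<le> b"
    using self_concordant_hessian_nonneg[OF sc1 i(1)] self_concordant_hessian_nonneg[OF sc2 i(2)]
    by (auto simp: a_def b_def)
  have \<nu>: "0 < \<nu>1" "0 < \<nu>2"
    using barrier_parameter_pos[OF B1 bounded(1) i(1)] barrier_parameter_pos[OF B2 bounded(2) i(2)] by auto
  have p: "p\<^sup>2 \<le> \<nu>1 * a" and q: "q\<^sup>2 \<le> \<nu>2 * b"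
    using self_concordant_barrierD(3)[OF B1 i(1)] self_concordant_barrierD(3)[OF B2 i(2)]
    by (auto simp: p_def q_def a_def b_def)
  have "(2 * (p * q))\<^sup>2 = 4 * (p\<^sup>2 * q\<^sup>2)"
    by (simp add: power_mult_distrib)
  also have "\<dots> \<le> 4 * ((\<nu>1 * a) * (\<nu>2 * b))"
    using p q ab \<nu> by (intro mult_left_mono mult_mono) auto
  also have "\<dots> = (\<nu>1 * b + \<nu>2 * a)\<^sup>2 - (\<nu>1 * b - \<nu>2 * a)\<^sup>2"
    by (simp add: power2_eq_square algebra_simps)
  also have "\<dots> \<le> (\<nu>1 * b + \<nu>2 * a)\<^sup>2"
    by simp
  finally have "2 * (p * q) \<le> \<nu>1 * b + \<nu>2 * a"
    by (rule power2_le_imp_le) (use ab \<nu> in simp)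
  then have "(p + q)\<^sup>2 \<le> (\<nu>1 + \<nu>2) * (a + b)"
    using p q by (simp add: power2_sum algebra_simps)
  moreover have "gradient F x \<bullet> h = p + q"
    by (simp add: gradient_eq[OF x] inner_block p_def q_def)
  ultimately show ?thesis
    by (simp add: hessian_form[OF x] a_def b_def)
qed

lemma barrier: "self_concordant_barrier (\<nu>1 + \<nu>2) X F"
  unfolding self_concordant_barrier_def using self_concordant blow_up gradient_bound by blast

end

lemma self_concordant_barrier_block_sum:
  fixes X1 :: "(real^'n1) set" and X2 :: "(real^'n2) set"
  assumes "self_concordant_barrier \<nu>1 X1 F1" "self_concordant_barrier \<nu>2 X2 F2" "bounded X1" "bounded X2"
  shows "self_concordant_barrier (\<nu>1 + \<nu>2) (block_product X1 X2) (block_sum F1 F2)"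
proof -
  interpret block_barriers \<nu>1 \<nu>2 X1 X2 F1 F2
    using assms by unfold_locales
  show ?thesis
    using barrier by (simp add: X_def F_def)
qed

section \<open>Counting the iterations\<close>

lemma barrier_minimizer_gradient:
  fixes F :: "real^'n \<Rightarrow> real"
  assumes B: "self_concordant_barrier \<nu> X F" and xc: "is_arg_min F (\<lambda>x. x \<in> interior X) xc"
  shows "gradient F xc = 0"
proof -
  have xc: "xc \<in> interior X" and min: "\<forall>x\<in>interior X. F xc \<le> F x"
    using xc by (auto simp: is_arg_min_def not_less)
  have "(F has_derivative (\<lambda>h. gradient F xc \<bullet> h)) (at xc)"
    using gradient_has_derivative self_concordant_onD(1)[OF self_concordant_barrierD(1)[OF B] open_interior xc] .
  from differential_zero_maxmin[OF xc open_interior this disjI2[OF min]]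
  have "gradient F xc \<bullet> gradient F xc = 0"
    by (rule fun_cong)
  then show ?thesis
    by simp
qed

text \<open>The tolerance is measured at the analytic center, the Newton step lives in the local norm
  at the current point; the factor \<open>2 (\<nu> + 2 sqrt \<nu>)\<close> in the tolerance pays for this change.\<close>

lemma accuracy_local:
  fixes F :: "real^'n \<Rightarrow> real"
  assumes B: "self_concordant_barrier \<nu> X F" and X: "bounded X"
    and xc: "is_arg_min F (\<lambda>x. x \<in> interior X) xc" and x: "x \<in> interior X"
    and t: "0 < t" and \<delta>: "0 < \<delta>" and acc: "dual_norm F xc u \<le> accuracy \<nu> t \<delta>"
  shows "dual_norm F x u \<le> t * \<delta>"
proof -
  define R where "R = 2 * (\<nu> + 2 * sqrt \<nu>)"
  have "0 < \<nu>"
    by (rule barrier_parameter_pos[OF B X x])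
  then have R: "0 < R"
    by (simp add: R_def add_pos_pos)
  have xc': "xc \<in> interior X"
    using xc by (simp add: is_arg_min_def)
  have "dual_norm F x u \<le> R * dual_norm F xc u"
    unfolding R_def by (rule dual_norm_le_center[OF B X xc' x barrier_minimizer_gradient[OF B xc]])
  also have "\<dots> \<le> R * (t * \<delta> / (R * (1 + \<delta>)))"
    using acc R by (intro mult_left_mono) (auto simp: accuracy_def R_def)
  also have "\<dots> = t * \<delta> / (1 + \<delta>)"
    using R by simp
  also have "\<dots> \<le> t * \<delta> / 1"
    using t \<delta> by (intro divide_left_mono) auto
  finally show ?thesis
    by simp
qed

text \<open>Every iteration that does not stop lowers the smoothed dual function by at least
  \<open>E = t omega (eta_lower \<delta> \<beta>)\<close>, since its decrement exceeds \<open>\<beta>\<close> and the decrease grows with the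
  decrement. The function starts at most \<open>t omega_star \<delta>\<close> above the value of the Lagrangian at the
  first point and never falls below its minimum at \<open>ys\<close>, which limits the number of iterations.\<close>

lemma damped_newton_iteration_bound:
  fixes F :: "real^'n \<Rightarrow> real" and A :: "real^'n^'m" and y :: "nat \<Rightarrow> real^'m"
  assumes B: "self_concordant_barrier \<nu> X F" and X: "bounded X"
    and xc: "is_arg_min F (\<lambda>x. x \<in> interior X) xc" and A: "rank A = CARD('m)" and t: "0 < t"
    and ys: "\<And>y'. smoothed_dual X F xc A b c ys t \<le> smoothed_dual X F xc A b c y' t"
    and \<beta>: "0 < \<beta>" and \<delta>: "0 < \<delta>" "\<delta> < 1" and disc: "4 * \<delta> \<le> (1 - \<delta>)\<^sup>2 * \<beta>"
    and run: "algorithm_run X F xc A b c t (accuracy \<nu> t \<delta>) \<delta> \<beta> xbar y"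
  shows "\<exists>J. terminates_in F A b t \<beta> xbar J \<and>
    real J \<le> (lagrangian_smoothed F xc A b c t (y 0) (xbar 0) - smoothed_dual X F xc A b c ys t
        + t * omega_star \<delta>) / (t * omega (eta_lower \<delta> \<beta>))"
proof -
  note sc = self_concordant_barrierD(1)[OF B] open_interior
  define L where "L = lagrangian_smoothed F xc A b c t"
  define d where "d v = smoothed_dual X F xc A b c v t" for v
  define l where "l j = newton_decrement F A b t (xbar j)" for j
  define E where "E = t * omega (eta_lower \<delta> \<beta>)"
  define runs where "runs j \<longleftrightarrow> (\<forall>k<j. \<not> l k \<le> \<beta>)" for j
  have d: "d v = (SUP x\<in>interior X. L v x)" for v
    by (simp add: d_def L_def smoothed_dual_def)
  have E: "0 < E"
    unfolding E_def using t omega_pos[OF eta_lower_mono(1)[OF \<delta> \<beta> disc order_refl]] by simp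
  have xbar: "xbar j \<in> interior X"
    and acc: "dual_norm F (xbar j) (c + transpose A *v y j - t *\<^sub>R gradient F (xbar j)) \<le> t * \<delta>"
    and y_Suc: "\<not> l j \<le> \<beta> \<Longrightarrow>
      y (Suc j) = y j - step_size \<delta> (l j) *\<^sub>R newton_direction F A b t (xbar j)"
    if "runs j" for j
  proof -
    have R: "xbar j \<in> interior X \<and>
        dual_norm F xc (c + transpose A *v y j - t *\<^sub>R gradient F (xbar j)) \<le> accuracy \<nu> t \<delta> \<and>
        (\<not> l j \<le> \<beta> \<longrightarrow>
          y (Suc j) = y j - step_size \<delta> (l j) *\<^sub>R newton_direction F A b t (xbar j))"
      using run that unfolding algorithm_run_def runs_def l_def by blast
    then show x: "xbar j \<in> interior X"
      by blast
    show "dual_norm F (xbar j) (c + transpose A *v y j - t *\<^sub>R gradient F (xbar j)) \<le> t * \<delta>"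
      using accuracy_local[OF B X xc x t \<delta>(1)] R by blast
    show "\<not> l j \<le> \<beta> \<Longrightarrow>
        y (Suc j) = y j - step_size \<delta> (l j) *\<^sub>R newton_direction F A b t (xbar j)"
      using R by blast
  qed
  note H = barrier_hessian_spd[OF B X xbar]
  have L_le: "L (y j) x \<le> L (y j) (xbar j) + t * omega_star \<delta>" if j: "runs j" and x: "x \<in> interior X" for j x
    unfolding L_def
  proof (rule lagrangian_smoothed_le[OF sc xbar[OF j] x t _ \<delta>(2)])
    fix h
    have "0 \<le> local_norm F (xbar j) h"
      using spd_nonneg[OF H[OF j]] by (simp add: local_norm_def)
    then show "(c + transpose A *v y j - t *\<^sub>R gradient F (xbar j)) \<bullet> h
        \<le> t * (\<delta> * local_norm F (xbar j) h)"
      using dual_norm_inner_le[OF H[OF j], of _ h] mult_right_mono[OF acc[OF j]]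
      by (metis mult.assoc order_trans)
  qed
  have d_le: "d (y j) \<le> L (y j) (xbar j) + t * omega_star \<delta>" if "runs j" for j
    unfolding d using xbar[OF that] L_le[OF that] by (intro cSUP_least) auto
  have L_le_d: "L (y j) (xbar j) \<le> d (y j)" if "runs j" for j
    unfolding d using xbar[OF that] L_le[OF that] by (intro cSUP_upper bdd_aboveI2)
  have descent: "d (y (Suc j)) \<le> d (y j) - E" if j: "runs j" and go: "\<not> l j \<le> \<beta>" for j
  proof -
    have l: "\<beta> \<le> l j" "0 < l j"
      using go \<beta> by auto
    have disc_l: "4 * \<delta> \<le> (1 - \<delta>)\<^sup>2 * l j"
      using disc l by (meson mult_left_mono order_trans zero_le_power2)
    have "L (y (Suc j)) z \<le> L (y j) (xbar j) - t * omega (eta_lower \<delta> (l j))" if z: "z \<in> interior X" for z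
      using damped_newton_step_descent[OF sc xbar[OF j] z H[OF j] A t acc[OF j] \<delta>, of b "y (Suc j)"]
        l disc_l y_Suc[OF j go] by (simp add: L_def l_def)
    then have "d (y (Suc j)) \<le> L (y j) (xbar j) - t * omega (eta_lower \<delta> (l j))"
      unfolding d using xbar[OF j] by (intro cSUP_least) auto
    moreover have "E \<le> t * omega (eta_lower \<delta> (l j))"
      unfolding E_def using t eta_lower_mono[OF \<delta> \<beta> disc l(1)]
      by (intro mult_left_mono omega_mono) auto
    ultimately show ?thesis
      using L_le_d[OF j] by linarith
  qed
  have total: "d (y J) + real J * E \<le> d (y 0)" if "runs J" for J
    using that
  proof (induction J)
    case (Suc J)
    then have "runs J" "\<not> l J \<le> \<beta>"
      by (auto simp: runs_def)
    then show ?case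
      using Suc.IH descent[of J] by (simp add: algebra_simps)
  qed simp
  define Q where "Q = (L (y 0) (xbar 0) - d ys + t * omega_star \<delta>) / E"
  have J_le: "real J \<le> Q" if "runs J" for J
  proof -
    have "real J * E \<le> L (y 0) (xbar 0) - d ys + t * omega_star \<delta>"
      using total[OF that] d_le[of 0] ys[of "y J"] by (simp add: runs_def d_def)
    then show ?thesis
      using E by (simp add: Q_def pos_le_divide_eq)
  qed
  obtain n where "Q < real n"
    using reals_Archimedean2 by blast
  then have "\<not> runs n"
    using J_le[of n] by auto
  then have ex: "\<exists>k. l k \<le> \<beta>"
    by (auto simp: runs_def)
  define J where "J = (LEAST k. l k \<le> \<beta>)"
  have "l J \<le> \<beta>" "runs J"
    using LeastI_ex[OF ex] not_less_Least by (auto simp: J_def runs_def)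
  then have "terminates_in F A b t \<beta> xbar J"
    by (simp add: terminates_in_def l_def runs_def)
  with J_le[OF \<open>runs J\<close>] show ?thesis
    unfolding Q_def E_def L_def d_def by blast
qed

theorem theorem4p5:
  fixes X1 :: "(real^'n1) set" and X2 :: "(real^'n2) set"
    and F1 :: "real^'n1 \<Rightarrow> real" and F2 :: "real^'n2 \<Rightarrow> real"
    and \<nu>1 \<nu>2 \<nu> :: real
    and X :: "(real^('n1::finite + 'n2::finite)) set" and F :: "real^('n1::finite + 'n2::finite) \<Rightarrow> real"
    and xc c :: "real^('n1::finite + 'n2::finite)"
    and A :: "real^('n1::finite + 'n2::finite)^'m" and b :: "real^'m"
    and Y :: "(real^'m) set"
    and \<delta>bar \<beta> t0 \<delta>hat :: real
    and xbar :: "nat \<Rightarrow> real^('n1::finite + 'n2::finite)" and y :: "nat \<Rightarrow> real^'m"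
  defines "X \<equiv> block_product X1 X2"
    and "F \<equiv> block_sum F1 F2"
    and "\<nu> \<equiv> \<nu>1 + \<nu>2"
  assumes "bounded X1" "closed X1" "convex X1" "interior X1 \<noteq> {}"
    and "bounded X2" "closed X2" "convex X2" "interior X2 \<noteq> {}"
    and "self_concordant_barrier \<nu>1 X1 F1"
    and "self_concordant_barrier \<nu>2 X2 F2"
    and "is_arg_min F (\<lambda>x. x \<in> interior X) xc"
    and "rank A = CARD('m)"
    and "\<exists>x. is_arg_max (\<lambda>x. c \<bullet> x) (\<lambda>x. A *v x = b \<and> x \<in> X) x"
    and "rel_interior X \<inter> {x. A *v x = b} \<noteq> {} \<or> polyhedron X"
    and "t0 > 0"
    and "\<exists>ys\<in>Y. \<forall>y'. smoothed_dual X F xc A b c ys t0 \<le> smoothed_dual X F xc A b c y' t0"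
    and "0 \<le> \<delta>bar" "\<delta>bar < delta_bar_max"
    and "beta_lower \<delta>bar < \<beta>" "\<beta> < beta_upper \<delta>bar"
    and "0 < \<delta>hat" "\<delta>hat < delta_hat_star \<beta>"
    and "y 0 \<in> Y"
    and "algorithm_run X F xc A b c t0 (accuracy \<nu> t0 \<delta>hat) \<delta>hat \<beta> xbar y"
  shows "\<exists>J. terminates_in F A b t0 \<beta> xbar J \<and>
    int (J + 1) \<le>
      \<lfloor>(lagrangian_smoothed F xc A b c t0 (y 0) (xbar 0)
          - (INF y'\<in>Y. smoothed_dual X F xc A b c y' t0)
          + t0 * omega_star \<delta>hat)
        / (t0 * omega (eta_lower \<delta>hat \<beta>))\<rfloor> + 1"
proof -
  have B: "self_concordant_barrier \<nu> X F"
    unfolding X_def F_def \<nu>_def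
    using \<open>self_concordant_barrier \<nu>1 X1 F1\<close> \<open>self_concordant_barrier \<nu>2 X2 F2\<close> \<open>bounded X1\<close> \<open>bounded X2\<close>
    by (rule self_concordant_barrier_block_sum)
  have X: "bounded X"
    unfolding X_def using \<open>bounded X1\<close> \<open>bounded X2\<close> by (rule bounded_block_product)
  have "\<delta>bar \<le> 1 / 10"
    using \<open>\<delta>bar < delta_bar_max\<close> delta_bar_max_le by linarith
  then have \<beta>: "0 < \<beta>"
    using beta_lower_nonneg[OF \<open>0 \<le> \<delta>bar\<close>] \<open>beta_lower \<delta>bar < \<beta>\<close> by linarith
  note \<delta> = \<open>0 < \<delta>hat\<close> \<open>\<delta>hat < delta_hat_star \<beta>\<close>
  obtain ys where ys: "ys \<in> Y"
      "\<And>y'. smoothed_dual X F xc A b c ys t0 \<le> smoothed_dual X F xc A b c y' t0"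
    using \<open>\<exists>ys\<in>Y. \<forall>y'. smoothed_dual X F xc A b c ys t0 \<le> smoothed_dual X F xc A b c y' t0\<close> by blast
  have "(INF y'\<in>Y. smoothed_dual X F xc A b c y' t0) = smoothed_dual X F xc A b c ys t0"
    using ys by (intro cInf_eq_minimum) auto
  then show ?thesis
    using damped_newton_iteration_bound[OF B X \<open>is_arg_min F (\<lambda>x. x \<in> interior X) xc\<close>
        \<open>rank A = CARD('m)\<close> \<open>t0 > 0\<close> ys(2) \<beta> \<delta>(1) delta_hat_discriminant[OF \<beta> \<delta>]
        \<open>algorithm_run X F xc A b c t0 (accuracy \<nu> t0 \<delta>hat) \<delta>hat \<beta> xbar y\<close>]
    by (auto simp: le_floor_iff)
qed

end
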